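(* Fix $d\ge 1$, a compact set $\mathcal X\subset\mathbb R^d$ of positive Lebesgue measure, constants $K>0$, $m\ge m_*\ge 1$, and teacher sequences $(L_n^*,N_n^*,S_n^*,B_n^*,F_n^* )$ with $L_n^*=O(1)$ and $N_n^*=O((\log n)^{m_*})$. Let $\mathcal P_n^*$ be the class of density pairs $(p,q)$ on $\mathcal X$ satisfying the teacher assumptions (A1)–(A3) stated in the context. Let $\mathcal F_n=\mathcal F^{\mathrm{DNN}}(L_n,N_n,S_n,B_n,F_n)$ be a student ReLU network family with $N_n=O((\log n)^m)$ and $L_n=O(1)$, which is larger than the teacher family in the sense that $L_n\ge L_n^*$, $S_n\ge S_n^*$, $N_n\ge N_n^*$, $B_n\ge B_n^*$. Let $\hat f_n\in\mathcal F_n$ be a minimizer over $\mathcal F_n$ of the empirical 0-1 risk based on $n$ i.i.d. observations $(\mathbf x_i,y_i)$. Then $$\sup_{(p,q)\in\mathcal P_n^*}\mathbb E\big[\mathcal E(\hat f_n,C_n^* )\big]=\tilde O_d\big(n^{-2/3}\big),$$ i.e. there are constants $C,\gamma>0$ not depending on $n$ ($\gamma$ may depend on $d$) such that for all sufficiently large $n$ the left-hand side is at most $C(\log n)^{\gamma}n^{-2/3}$.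
   Context: ReLU networks: $\sigma(x)=\max\{x,0\}$ applied coordinatewise. A ReLU network with $L$ hidden layers and parameters $\Theta=\{(W^{(l)},b^{(l)})\}_{l=1}^{L+1}$ is $f(\mathbf x|\Theta)=W^{(L+1)}\sigma(W^{(L)}\sigma(\cdots\sigma(W^{(1)}\mathbf x+b^{(1)})\cdots)+b^{(L)})+b^{(L+1)}$, real-valued on $\mathbb R^d$. $|\Theta|$ is the number of hidden layers, $N_{\max}(\Theta)$ the maximal width, $\|\Theta\|_0$ the number of nonzero parameters, $\|\Theta\|_\infty$ the largest absolute value of a parameter. $\mathcal F^{\mathrm{DNN}}(L,N,S,B,F)$ is the set of all such $f(\cdot|\Theta)$ with $|\Theta|\le L$, $N_{\max}(\Theta)\le N$, $\|\Theta\|_0\le S$, $\|\Theta\|_\infty\le B$, $\sup_{\mathbf x\in\mathcal X}|f(\mathbf x|\Theta)|\le F$ (with $S,B,F\in(0,\infty]$). Classification model: $y\in\{-1,1\}$ with $P(y=1)=P(y=-1)=1/2$; $\mathbf x|y=1$ has density $p$ and $\mathbf x|y=-1$ has density $q$ on $\mathcal X$ with respect to Lebesgue measure $\mathbb Q$. The data $(\mathbf x_i,y_i)$, $i=1,\dots,n$, are i.i.d. from this model. A function $f$ defines the classifier $C_f(\mathbf x)=1$ if $f(\mathbf x)\ge 0$ and $C_f(\mathbf x)=-1$ otherwise. Risk: $R(C)=P(C(\mathbf x)\ne y)$; the empirical 0-1 risk of $f$ is $\frac1n\sum_{i=1}^n \mathbb I\{C_f(\mathbf x_i)\ne y_i\}$.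 The Bayes classifier $C_n^*$ assigns label $1$ on $\{\mathbf x\in\mathcal X:p(\mathbf x)\ge q(\mathbf x)\}$ and $-1$ elsewhere. Excess risk: $\mathcal E(f,C_n^* )=R(C_f)-R(C_n^* )$. Teacher assumptions defining $\mathcal P_n^*$ ($p,q$ may depend on $n$; the constant $K$ does not): $p,q$ are densities bounded by $K$, and (A1) $p,q$ have compact supports (in $\mathcal X$); (A2) $p-q=f_n^*$ on $\mathcal X$ for some $f_n^*\in\mathcal F_n^*=\mathcal F^{\mathrm{DNN}}(L_n^*,N_n^*,S_n^*,B_n^*,F_n^* )$; (A3) there exist $c_n,T_n>0$ with $c_n\le K(\log n)^{m_*d^2L_n^*}$ and $1/T_n\le K(\log n)^{m_*d^2L_n^*}$ such that $\mathbb Q\{\mathbf x\in\mathcal X:|f_n^*(\mathbf x)|\le t\}\le c_nt$ for all $0\le t\le T_n$. *)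

theory Defs
  imports
    "HOL-Probability.Probability"
    "Jordan_Normal_Form.Matrix"
begin

section \<open>ReLU networks\<close>

text \<open>
  A parameter \<open>\<Theta>\<close> is the list of layers \<open>(W\<^sub>l, b\<^sub>l)\<close>, \<open>l = 1, \<dots>, L + 1\<close>, so a network with
  \<open>L\<close> hidden layers is a list of length \<open>L + 1\<close>. Hidden widths vary freely, hence matrices and
  vectors with explicit dimensions are used. Only the input space has a fixed dimension and is
  the type \<open>real ^ 'd\<close>.
\<close>

type_synonym relu_params = "(real mat \<times> real Matrix.vec) list"

text \<open>
  The enumeration \<^term>\<open>from_nat_into (UNIV :: 'd set)\<close> is a bijection from \<open>{..<CARD('d)}\<close>
  onto \<open>'d\<close> (lemma \<open>bij_betw_from_nat_into_finite\<close>). The network classes below do not depend on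
  its choice, since the columns of the first weight matrix can be permuted.
\<close>

definition input_vec :: "real ^ 'd \<Rightarrow> real Matrix.vec" where
  "input_vec x = Matrix.vec CARD('d) (\<lambda>i. vec_nth x (from_nat_into (UNIV :: 'd set) i))"

definition relu_vec :: "real Matrix.vec \<Rightarrow> real Matrix.vec" where
  "relu_vec v = map_vec (\<lambda>t. max t 0) v"

text \<open>The first argument is the input dimension of the remaining layers; the output is scalar.\<close>

fun wf_params :: "nat \<Rightarrow> relu_params \<Rightarrow> bool" where
  "wf_params k [] \<longleftrightarrow> False"
| "wf_params k [(W, b)] \<longleftrightarrow> dim_row W = 1 \<and> dim_col W = k \<and> dim_vec b = 1"
| "wf_params k ((W, b) # l # \<Theta>) \<longleftrightarrow>
     0 < dim_row W \<and> dim_col W = k \<and> dim_vec b = dim_row W \<and>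
     wf_params (dim_row W) (l # \<Theta>)"

text \<open>The empty list is not a network (see \<^const>\<open>wf_params\<close>); its value is a dummy.\<close>

fun net_eval :: "relu_params \<Rightarrow> real Matrix.vec \<Rightarrow> real Matrix.vec" where
  "net_eval [] v = v"
| "net_eval [(W, b)] v = W *\<^sub>v v + b"
| "net_eval ((W, b) # l # \<Theta>) v = net_eval (l # \<Theta>) (relu_vec (W *\<^sub>v v + b))"

definition net_fun :: "relu_params \<Rightarrow> real ^ 'd \<Rightarrow> real" where
  "net_fun \<Theta> x = vec_index (net_eval \<Theta> (input_vec x)) 0"

definition hidden_layers :: "relu_params \<Rightarrow> nat" where
  "hidden_layers \<Theta> = length \<Theta> - 1"

text \<open>The maximum is over the hidden layers only, and is \<open>0\<close> if there are none.\<close>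

definition max_width :: "relu_params \<Rightarrow> nat" where
  "max_width \<Theta> = Max (insert 0 ((\<lambda>(W, b). dim_row W) ` set (butlast \<Theta>)))"

definition norm0_params :: "relu_params \<Rightarrow> nat" where
  "norm0_params \<Theta> = (\<Sum>(W, b)\<leftarrow>\<Theta>.
     card {(i, j). i < dim_row W \<and> j < dim_col W \<and> W $$ (i, j) \<noteq> 0} +
     card {i. i < dim_vec b \<and> vec_index b i \<noteq> 0})"

definition norm_inf_params :: "relu_params \<Rightarrow> real" where
  "norm_inf_params \<Theta> = Max (abs ` (\<Union>(W, b)\<in>set \<Theta>. elements_mat W \<union> vec_set b))"

definition dnn_class ::
    "(real ^ 'd) set \<Rightarrow> nat \<Rightarrow> nat \<Rightarrow> ereal \<Rightarrow> ereal \<Rightarrow> ereal \<Rightarrow> (real ^ 'd \<Rightarrow> real) set" where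
  "dnn_class X L N S B F = {f. \<exists>\<Theta>. f = net_fun \<Theta> \<and> wf_params CARD('d) \<Theta> \<and>
     hidden_layers \<Theta> \<le> L \<and> max_width \<Theta> \<le> N \<and>
     ereal (real (norm0_params \<Theta>)) \<le> S \<and> ereal (norm_inf_params \<Theta>) \<le> B \<and>
     (SUP x\<in>X. ereal \<bar>f x\<bar>) \<le> F}"


section \<open>The classification model\<close>

definition bounded_density :: "(real ^ 'd) set \<Rightarrow> real \<Rightarrow> (real ^ 'd \<Rightarrow> real) \<Rightarrow> bool" where
  "bounded_density X K p \<longleftrightarrow>
     p \<in> borel_measurable (restrict_space lborel X) \<and>
     (\<forall>x\<in>X. 0 \<le> p x \<and> p x \<le> K) \<and>
     (\<integral>\<^sup>+x. ennreal (p x) \<partial>restrict_space lborel X) = 1"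

text \<open>
  The joint law of \<open>(x, y)\<close> on \<open>X \<times> {-1, 1}\<close>, given by its density with respect to the product
  of Lebesgue and counting measure: labels have probability \<open>1/2\<close> each, and \<open>x\<close> has conditional
  density \<open>p\<close> given \<open>y = 1\<close> and \<open>q\<close> given \<open>y = -1\<close> (see \<open>emeasure_class_law\<close> below).
\<close>

definition class_law ::
    "(real ^ 'd) set \<Rightarrow> (real ^ 'd \<Rightarrow> real) \<Rightarrow> (real ^ 'd \<Rightarrow> real) \<Rightarrow> ((real ^ 'd) \<times> int) measure" where
  "class_law X p q =
     density (restrict_space lborel X \<Otimes>\<^sub>M count_space {-1, 1})
       (\<lambda>(x, y). ennreal ((1 / 2) * (if y = 1 then p x else q x)))"

definition sample_law ::
    "nat \<Rightarrow> (real ^ 'd) set \<Rightarrow> (real ^ 'd \<Rightarrow> real) \<Rightarrow> (real ^ 'd \<Rightarrow> real) \<Rightarrow>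
     (nat \<Rightarrow> (real ^ 'd) \<times> int) measure" where
  "sample_law n X p q = PiM {..<n} (\<lambda>_. class_law X p q)"

definition classifier :: "(real ^ 'd \<Rightarrow> real) \<Rightarrow> real ^ 'd \<Rightarrow> int" where
  "classifier f x = (if f x \<ge> 0 then 1 else -1)"

definition bayes_classifier ::
    "(real ^ 'd) set \<Rightarrow> (real ^ 'd \<Rightarrow> real) \<Rightarrow> (real ^ 'd \<Rightarrow> real) \<Rightarrow> real ^ 'd \<Rightarrow> int" where
  "bayes_classifier X p q x = (if x \<in> {x\<in>X. p x \<ge> q x} then 1 else -1)"

definition risk ::
    "(real ^ 'd) set \<Rightarrow> (real ^ 'd \<Rightarrow> real) \<Rightarrow> (real ^ 'd \<Rightarrow> real) \<Rightarrow> (real ^ 'd \<Rightarrow> int) \<Rightarrow> real" where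
  "risk X p q C =
     measure (class_law X p q) {z \<in> space (class_law X p q). C (fst z) \<noteq> snd z}"

definition excess_risk ::
    "(real ^ 'd) set \<Rightarrow> (real ^ 'd \<Rightarrow> real) \<Rightarrow> (real ^ 'd \<Rightarrow> real) \<Rightarrow> (real ^ 'd \<Rightarrow> real) \<Rightarrow> real" where
  "excess_risk X p q f = risk X p q (classifier f) - risk X p q (bayes_classifier X p q)"

definition empirical_risk ::
    "nat \<Rightarrow> (nat \<Rightarrow> (real ^ 'd) \<times> int) \<Rightarrow> (real ^ 'd \<Rightarrow> real) \<Rightarrow> real" where
  "empirical_risk n D f =
     (1 / real n) * (\<Sum>i<n. of_bool (classifier f (fst (D i)) \<noteq> snd (D i)))"


section \<open>The teacher class\<close>

definition has_compact_support :: "(real ^ 'd) set \<Rightarrow> (real ^ 'd \<Rightarrow> real) \<Rightarrow> bool" where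
  "has_compact_support X p \<longleftrightarrow>
     compact (closure {x\<in>X. p x \<noteq> 0}) \<and> closure {x\<in>X. p x \<noteq> 0} \<subseteq> X"

definition noise_bound :: "nat \<Rightarrow> real \<Rightarrow> real \<Rightarrow> nat \<Rightarrow> nat \<Rightarrow> real" where
  "noise_bound d K m n L = K * ln (real n) powr (m * (real d)\<^sup>2 * real L)"

definition teacher_pairs ::
    "(real ^ 'd) set \<Rightarrow> real \<Rightarrow> real \<Rightarrow> nat \<Rightarrow> nat \<Rightarrow> nat \<Rightarrow> ereal \<Rightarrow> ereal \<Rightarrow> ereal \<Rightarrow>
     ((real ^ 'd \<Rightarrow> real) \<times> (real ^ 'd \<Rightarrow> real)) set" where
  "teacher_pairs X K m n L N S B F = {(p, q).
     bounded_density X K p \<and> bounded_density X K q \<and>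
     has_compact_support X p \<and> has_compact_support X q \<and>
     (\<exists>f \<in> dnn_class X L N S B F.
        (\<forall>x\<in>X. p x - q x = f x) \<and>
        (\<exists>c T. 0 < c \<and> 0 < T \<and>
           c \<le> noise_bound CARD('d) K m n L \<and>
           1 / T \<le> noise_bound CARD('d) K m n L \<and>
           (\<forall>t. 0 \<le> t \<and> t \<le> T \<longrightarrow> measure lborel {x\<in>X. \<bar>f x\<bar> \<le> t} \<le> c * t)))}"


section \<open>Consistency of the joint law with the model\<close>

lemma emeasure_class_law:
  fixes X :: "(real ^ 'd) set"
  assumes p: "bounded_density X K p" and q: "bounded_density X K q"
    and A: "A \<in> sets (restrict_space lborel X)" and y: "y \<in> {-1, 1}"
  shows "emeasure (class_law X p q) (A \<times> {y}) =
    ennreal (1 / 2) *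
      (\<integral>\<^sup>+x. ennreal ((if y = 1 then p else q) x) * indicator A x \<partial>restrict_space lborel X)"
proof -
  let ?R = "restrict_space lborel X" and ?C = "count_space {-1, 1 :: int}"
  let ?g = "\<lambda>(x, y). ennreal ((1 / 2) * (if y = 1 then p x else q x))"
  have sf: "sigma_finite_measure ?C"
    by (rule sigma_finite_measure_count_space_finite) simp
  have mp [measurable]: "p \<in> borel_measurable ?R" "q \<in> borel_measurable ?R"
    using p q by (auto simp: bounded_density_def)
  have A' [measurable]: "A \<in> sets ?R" by (rule A)
  have mg: "?g \<in> borel_measurable (?R \<Otimes>\<^sub>M ?C)"
    by measurable
  have S: "A \<times> {y} \<in> sets (?R \<Otimes>\<^sub>M ?C)"
    using y by (intro pair_measureI A) auto
  have "emeasure (class_law X p q) (A \<times> {y}) =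
      (\<integral>\<^sup>+z. ?g z * indicator (A \<times> {y}) z \<partial>(?R \<Otimes>\<^sub>M ?C))"
    unfolding class_law_def by (rule emeasure_density[OF mg S])
  also have "\<dots> = (\<integral>\<^sup>+x. \<integral>\<^sup>+y'. ?g (x, y') * indicator (A \<times> {y}) (x, y') \<partial>?C \<partial>?R)"
    by (rule sigma_finite_measure.nn_integral_fst[OF sf, symmetric])
      (intro borel_measurable_times_ennreal mg borel_measurable_indicator S)
  also have "\<dots> = (\<integral>\<^sup>+x. ennreal (1 / 2) *
      (ennreal ((if y = 1 then p else q) x) * indicator A x) \<partial>?R)"
  proof (rule nn_integral_cong)
    fix x assume "x \<in> space ?R"
    hence "0 \<le> p x" "0 \<le> q x"
      using p q by (auto simp: bounded_density_def space_restrict_space)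
    thus "(\<integral>\<^sup>+y'. ?g (x, y') * indicator (A \<times> {y}) (x, y') \<partial>?C) =
        ennreal (1 / 2) * (ennreal ((if y = 1 then p else q) x) * indicator A x)"
      using y by (subst nn_integral_count_space_finite)
        (use ennreal_mult[of "1 / 2" "p x"] ennreal_mult[of "1 / 2" "q x"] in
          \<open>auto simp: indicator_def\<close>)
  qed
  also have "\<dots> = ennreal (1 / 2) *
      (\<integral>\<^sup>+x. ennreal ((if y = 1 then p else q) x) * indicator A x \<partial>?R)"
    by (rule nn_integral_cmult) (cases "y = 1"; simp; measurable)
  finally show ?thesis .
qed

end

theory Submission
  imports Defs "HOL-Real_Asymp.Real_Asymp"
begin

text \<open>
  Let \<open>g\<close> be the difference of the 0-1 losses of the empirical risk minimizer and of the Bayes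
  classifier, which is attained in the student class by rescaling the last layer of the teacher.
  Then \<open>g\<close> takes values in \<open>{-1, 0, 1}\<close>, its mean \<open>e\<close> is the excess risk, and the margin
  condition at level \<open>t\<close> gives \<open>E[g\<^sup>2] \<le> K c t + (2 K / t) e\<close>. Swapping the sample with a ghost
  sample bounds the exponential moment of \<open>\<eta> n (e - 3 \<eta> E[g\<^sup>2]) / 2\<close> by the number \<open>M\<close> of sign
  patterns of the class on \<open>2 n\<close> points. With \<open>\<eta>\<close> proportional to \<open>t\<close> the second moment is absorbed,
  \<open>E[e] \<le> c t\<^sup>2 / 2 + 48 K ln M / (t n)\<close>, and \<open>t = n\<^sup>-\<^sup>1\<^sup>/\<^sup>3\<close> gives the rate. For bounded depth,
  \<open>ln M\<close> is polylogarithmic: given the activation pattern of a layer, the next layer is linear in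
  features of polynomially larger dimension, so patterns can be counted layer by layer with the
  bound for half-spaces. Measurability of the suprema is obtained from networks with rational
  parameters, which realise all finite sign patterns.
\<close>

section \<open>Sign patterns of half-spaces\<close>

text \<open>The exponent comes from a balance. Optimised over the level, the second moment bound has
  order \<open>sqrt e\<close>, attained for \<open>t\<close> of order \<open>sqrt e\<close>. Fixing
  \<open>t\<close> in advance keeps the bound linear in \<open>e\<close>, so it can be absorbed
  without slicing the class into shells of comparable excess risk. The bias
  \<open>c * t\<^sup>2\<close> and the stochastic term \<open>ln M / (t * n)\<close> are then, up to
  logarithms, of the same order exactly at the stated \<open>t\<close>.

  The student's weights may be unbounded, which rules out covering numbers in the sup norm. The 0-1
  loss, however, sees a network only through its sign, so on finitely many points the class is
  finite, and the ghost sample is what reduces population means to finitely many points. The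
  remaining obstacle is that the minimizer is an arbitrary choice for each sample and that the class
  is uncountable. The exponential moment is therefore dominated, sample by sample, by a supremum
  over a countable family that imitates every network on any given \<open>2 * n\<close>
  points.\<close>

definition shatters :: "'a set set \<Rightarrow> 'a set \<Rightarrow> bool" where
  "shatters F S \<longleftrightarrow> Pow S \<subseteq> (\<lambda>A. A \<inter> S) ` F"

text \<open>Pajor's form of the Sauer-Shelah lemma. Splitting at \<open>x\<close> gives
  \<open>card F = card F0 + card F1\<close>. A set shattered by \<open>F0\<close> or
  \<open>F1\<close> is shattered by \<open>F\<close>; a set shattered by both is counted twice on
  the right, and its second copy is paid for by adding \<open>x\<close> to it.\<close>

lemma card_le_card_shattered:
  assumes "finite I" and "F \<subseteq> Pow I"
  shows "card F \<le> card {S \<in> Pow I. shatters F S}"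
  using assms
proof (induction I arbitrary: F rule: finite_induct)
  case empty
  show ?case
  proof (cases "F = {}")
    case False
    then have "F = {{}}" using empty by auto
    then have "{S \<in> Pow {}. shatters F S} = {{}}" by (auto simp: shatters_def)
    then show ?thesis using \<open>F = {{}}\<close> by simp
  qed simp
next
  case (insert x I)
  define F0 where "F0 = {A \<in> F. x \<notin> A}"
  define F1 where "F1 = {A \<in> Pow I. insert x A \<in> F}"
  let ?sh = "\<lambda>I F. {S \<in> Pow I. shatters F S}"
  have sub: "F0 \<subseteq> Pow I" "F1 \<subseteq> Pow I" using insert.prems by (auto simp: F0_def F1_def)
  have fin: "finite F0" "finite F1" "finite (?sh I F0)" "finite (?sh I F1)"
    using sub insert.hyps by (auto intro: finite_subset)
  have inj: "inj_on (insert x) (Pow I)"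
    using insert.hyps by (auto simp: inj_on_def)
  have F: "F = F0 \<union> insert x ` F1"
  proof (rule Set.set_eqI)
    fix A
    show "A \<in> F \<longleftrightarrow> A \<in> F0 \<union> insert x ` F1"
    proof (cases "x \<in> A")
      case True
      then have eq: "insert x (A - {x}) = A" by auto
      have "A \<in> insert x ` F1" if "A \<in> F"
      proof (rule rev_image_eqI)
        show "A - {x} \<in> F1" using that insert.prems eq by (auto simp: F1_def)
      qed (rule eq[symmetric])
      then show ?thesis using True by (auto simp: F0_def F1_def)
    next
      case False
      then show ?thesis by (auto simp: F0_def F1_def)
    qed
  qed
  have disj: "F0 \<inter> insert x ` F1 = {}" by (auto simp: F0_def)
  have "card F = card F0 + card F1"
    unfolding F using fin disj inj sub
    by (subst card_Un_disjoint) (auto intro!: card_image inj_on_subset[OF inj])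
  also have "\<dots> \<le> card (?sh I F0) + card (?sh I F1)"
    using insert.IH[OF sub(1)] insert.IH[OF sub(2)] by simp
  also have "\<dots> = card (?sh I F0 \<union> ?sh I F1) + card (?sh I F0 \<inter> ?sh I F1)"
    by (rule card_Un_Int[OF fin(3,4)])
  also have "card (?sh I F0 \<inter> ?sh I F1) = card (insert x ` (?sh I F0 \<inter> ?sh I F1))"
    by (rule card_image[symmetric], rule inj_on_subset[OF inj]) auto
  also have "card (?sh I F0 \<union> ?sh I F1) + \<dots> =
      card ((?sh I F0 \<union> ?sh I F1) \<union> insert x ` (?sh I F0 \<inter> ?sh I F1))"
    using insert.hyps fin by (intro card_Un_disjoint[symmetric]) auto
  also have "\<dots> \<le> card (?sh (insert x I) F)"
  proof (rule card_mono)
    show "finite (?sh (insert x I) F)" using insert.hyps by auto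
    have s0: "shatters F S" if "shatters F0 S" for S
      using that by (auto simp: shatters_def F0_def)
    have s1: "shatters F S" if SI: "S \<subseteq> I" and S1: "shatters F1 S" for S
    proof (unfold shatters_def, rule subsetI)
      fix T assume "T \<in> Pow S"
      then have "T \<in> (\<lambda>A. A \<inter> S) ` F1" using S1 unfolding shatters_def by (rule subsetD[rotated])
      then obtain A where A: "A \<in> F1" "T = A \<inter> S" by (rule imageE)
      then have "insert x A \<in> F" "T = insert x A \<inter> S"
        using SI insert.hyps by (auto simp: F1_def)
      then show "T \<in> (\<lambda>A. A \<inter> S) ` F" by blast
    qed
    have s2: "shatters F (insert x S)" if S0: "shatters F0 S" and S1: "shatters F1 S" for S
    proof (unfold shatters_def, rule subsetI)
      fix T assume T: "T \<in> Pow (insert x S)"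
      show "T \<in> (\<lambda>A. A \<inter> insert x S) ` F"
      proof (cases "x \<in> T")
        case True
        have "T - {x} \<in> Pow S" using T by auto
        then have "T - {x} \<in> (\<lambda>A. A \<inter> S) ` F1" using S1 unfolding shatters_def by (rule subsetD[rotated])
        then obtain A where A: "A \<in> F1" "T - {x} = A \<inter> S" by (rule imageE)
        then have "insert x A \<in> F" "T = insert x A \<inter> insert x S"
          using True by (auto simp: F1_def)
        then show ?thesis by blast
      next
        case False
        then have "T \<in> Pow S" using T by auto
        then have "T \<in> (\<lambda>A. A \<inter> S) ` F0" using S0 unfolding shatters_def by (rule subsetD[rotated])
        then obtain A where A: "A \<in> F0" "T = A \<inter> S" by (rule imageE)
        then have "A \<in> F" "T = A \<inter> insert x S"
          by (auto simp: F0_def)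
        then show ?thesis by blast
      qed
    qed
    show "(?sh I F0 \<union> ?sh I F1) \<union> insert x ` (?sh I F0 \<inter> ?sh I F1) \<subseteq> ?sh (insert x I) F"
      using s0 s1 s2 by auto
  qed
  finally show ?case .
qed

text \<open>The sum of binomial coefficients is compared term by term with the binomial expansion of
  \<open>(card I + 1) ^ D\<close>.\<close>

lemma card_subsets_card_le:
  assumes "finite I"
  shows "card {S \<in> Pow I. card S \<le> D} \<le> (card I + 1) ^ D"
proof -
  have eq: "{S \<in> Pow I. card S \<le> D} = (\<Union>k\<le>D. {S. S \<subseteq> I \<and> card S = k})" by auto
  have "card {S \<in> Pow I. card S \<le> D} \<le> (\<Sum>k\<le>D. card {S. S \<subseteq> I \<and> card S = k})"
    unfolding eq by (rule card_UN_le) simp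
  also have "\<dots> = (\<Sum>k\<le>D. card I choose k)"
    using n_subsets[OF assms] by simp
  also have "\<dots> \<le> (\<Sum>k\<le>D. (D choose k) * card I ^ k * 1 ^ (D - k))"
  proof (rule sum_mono)
    fix k assume k: "k \<in> {..D}"
    have "(card I choose k) \<le> card I ^ k"
      by (cases "k \<le> card I") (auto simp: binomial_le_pow binomial_eq_0)
    also have "\<dots> \<le> (D choose k) * card I ^ k"
      using k by (simp add: Suc_le_eq)
    finally show "(card I choose k) \<le> (D choose k) * card I ^ k * 1 ^ (D - k)" by simp
  qed
  also have "\<dots> = (card I + 1) ^ D"
    using binomial_ring[of "card I" 1 D] by simp
  finally show ?thesis .
qed

text \<open>Gaussian elimination: a pivot \<open>j\<close> clears coordinate \<open>D\<close> of all
  other vectors, which leaves one vector and one coordinate fewer; the coefficient of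
  \<open>j\<close> is recovered at the end.\<close>

lemma exists_linear_dependence:
  fixes \<psi> :: "'i \<Rightarrow> nat \<Rightarrow> real"
  assumes "finite I" and "D < card I"
  shows "\<exists>c. (\<exists>i\<in>I. c i \<noteq> 0) \<and> (\<forall>m<D. (\<Sum>i\<in>I. c i * \<psi> i m) = 0)"
  using assms
proof (induction D arbitrary: I \<psi>)
  case 0
  then have "I \<noteq> {}" by auto
  then show ?case by (intro exI[of _ "\<lambda>_. 1"]) auto
next
  case (Suc D)
  show ?case
  proof (cases "\<forall>i\<in>I. \<psi> i D = 0")
    case True
    obtain c where c: "\<exists>i\<in>I. c i \<noteq> 0" "\<forall>m<D. (\<Sum>i\<in>I. c i * \<psi> i m) = 0"
      using Suc.IH[of I \<psi>] Suc.prems by auto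
    have "(\<Sum>i\<in>I. c i * \<psi> i m) = 0" if "m < Suc D" for m
      using that c(2) True by (cases "m = D") auto
    then show ?thesis using c(1) by blast
  next
    case False
    then obtain j where j: "j \<in> I" "\<psi> j D \<noteq> 0" by auto
    define r where "r i = \<psi> i D / \<psi> j D" for i
    have "finite (I - {j})" "D < card (I - {j})" using Suc.prems j by auto
    from Suc.IH[OF this, of "\<lambda>i m. \<psi> i m - r i * \<psi> j m"]
    obtain c where c: "\<exists>i\<in>I - {j}. c i \<noteq> 0"
      "\<forall>m<D. (\<Sum>i\<in>I - {j}. c i * (\<psi> i m - r i * \<psi> j m)) = 0" by auto
    define c' where "c' = c(j := - (\<Sum>i\<in>I - {j}. c i * r i))"
    have *: "(\<Sum>i\<in>I. c' i * \<psi> i m) = (\<Sum>i\<in>I - {j}. c i * (\<psi> i m - r i * \<psi> j m))" for m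
    proof -
      have "(\<Sum>i\<in>I. c' i * \<psi> i m) = c' j * \<psi> j m + (\<Sum>i\<in>I - {j}. c' i * \<psi> i m)"
        using Suc.prems(1) j(1) by (rule sum.remove)
      also have "(\<Sum>i\<in>I - {j}. c' i * \<psi> i m) = (\<Sum>i\<in>I - {j}. c i * \<psi> i m)"
        by (rule sum.cong) (auto simp: c'_def)
      finally have "(\<Sum>i\<in>I. c' i * \<psi> i m) =
          (\<Sum>i\<in>I - {j}. c i * \<psi> i m) - (\<Sum>i\<in>I - {j}. c i * r i) * \<psi> j m"
        by (simp add: c'_def)
      then show ?thesis
        by (simp add: sum_subtractf sum_distrib_right right_diff_distrib mult.assoc)
    qed
    have "(\<Sum>i\<in>I. c' i * \<psi> i m) = 0" if "m < Suc D" for m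
    proof (cases "m = D")
      case True
      then show ?thesis unfolding * using j(2) by (simp add: r_def)
    qed (use that c(2) in \<open>simp add: *\<close>)
    moreover have "\<exists>i\<in>I. c' i \<noteq> 0" using c(1) by (auto simp: c'_def)
    ultimately show ?thesis by blast
  qed
qed

text \<open>Sets of indices instead of points, because sample points may coincide. The half-spaces
  are homogeneous; a bias is modelled by a constant feature.\<close>

definition half_spaces :: "nat \<Rightarrow> ('i \<Rightarrow> nat \<Rightarrow> real) \<Rightarrow> 'i set \<Rightarrow> 'i set set" where
  "half_spaces D \<psi> I = range (\<lambda>w. {i \<in> I. 0 \<le> (\<Sum>m<D. w m * \<psi> i m)})"

lemma half_spaces_subset: "half_spaces D \<psi> I \<subseteq> Pow I"
  by (auto simp: half_spaces_def)

lemma finite_half_spaces: "finite I \<Longrightarrow> finite (half_spaces D \<psi> I)"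
  by (rule finite_subset[OF half_spaces_subset]) simp

text \<open>A linear dependence \<open>c\<close> among more than \<open>D\<close> feature vectors
  excludes one labelling: a functional \<open>h\<close> that is nonnegative exactly where
  \<open>c\<close> is would make the vanishing sum of \<open>c i * h i\<close> positive.\<close>

lemma card_shattered_half_spaces:
  assumes "finite I" and "S \<subseteq> I" and "shatters (half_spaces D \<psi> I) S"
  shows "card S \<le> D"
proof (rule ccontr)
  assume "\<not> card S \<le> D"
  moreover have fS: "finite S" using assms(1,2) finite_subset by blast
  ultimately obtain c0 where c0: "\<exists>i\<in>S. c0 i \<noteq> 0" "\<forall>m<D. (\<Sum>i\<in>S. c0 i * \<psi> i m) = 0"
    using exists_linear_dependence[of S D \<psi>] by auto
  \<comment> \<open>The half-spaces are closed, so \<open>h\<close> may vanish where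
    \<open>c\<close> is positive. Only a negative coefficient forces \<open>c i * h i\<close> to be
    strictly positive; changing the sign of \<open>c0\<close> provides one if necessary.\<close>
  obtain c where c: "\<exists>i\<in>S. c i < 0" "\<forall>m<D. (\<Sum>i\<in>S. c i * \<psi> i m) = 0"
  proof (cases "\<exists>i\<in>S. c0 i < 0")
    case False
    have "\<forall>m<D. (\<Sum>i\<in>S. - c0 i * \<psi> i m) = 0" using c0(2) by (simp add: sum_negf)
    moreover have "\<exists>i\<in>S. - c0 i < 0" using False c0(1) by (auto simp: not_less order.order_iff_strict)
    ultimately show ?thesis using that[of "\<lambda>i. - c0 i"] by blast
  qed (use c0 that in blast)
  have "{i \<in> S. 0 \<le> c i} \<in> Pow S" by auto
  then have "{i \<in> S. 0 \<le> c i} \<in> (\<lambda>A. A \<inter> S) ` half_spaces D \<psi> I"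
    using assms(3) unfolding shatters_def by (rule subsetD[rotated])
  then obtain w where w: "{i \<in> S. 0 \<le> c i} = {i \<in> I. 0 \<le> (\<Sum>m<D. w m * \<psi> i m)} \<inter> S"
    unfolding half_spaces_def by (elim imageE rangeE) simp
  define h where "h i = (\<Sum>m<D. w m * \<psi> i m)" for i
  have hc: "0 \<le> h i \<longleftrightarrow> 0 \<le> c i" if "i \<in> S" for i
  proof -
    have "i \<in> {i \<in> S. 0 \<le> c i} \<longleftrightarrow> i \<in> {i \<in> I. 0 \<le> (\<Sum>m<D. w m * \<psi> i m)} \<inter> S"
      by (simp only: w)
    then show ?thesis using that assms(2) by (auto simp: h_def)
  qed
  have "(\<Sum>i\<in>S. c i * h i) = (\<Sum>m<D. w m * (\<Sum>i\<in>S. c i * \<psi> i m))"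
    unfolding h_def sum_distrib_left by (subst sum.swap) (simp add: mult_ac)
  also have "\<dots> = 0" using c(2) by simp
  finally have "(\<Sum>i\<in>S. c i * h i) = 0" .
  moreover have "0 < (\<Sum>i\<in>S. c i * h i)"
  proof -
    obtain i where i: "i \<in> S" "c i < 0" using c(1) by auto
    have "0 < c i * h i" using i hc[OF i(1)] by (intro mult_neg_neg) auto
    moreover have "0 \<le> c j * h j" if "j \<in> S" for j
      using hc[OF that] by (cases "0 \<le> c j") (auto intro: mult_nonpos_nonpos)
    ultimately show ?thesis using fS i(1) by (intro sum_pos2) auto
  qed
  ultimately show False by simp
qed

lemma card_half_spaces_le:
  assumes "finite I"
  shows "card (half_spaces D \<psi> I) \<le> (card I + 1) ^ D"
proof -
  have "card (half_spaces D \<psi> I) \<le> card {S \<in> Pow I. shatters (half_spaces D \<psi> I) S}"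
    by (rule card_le_card_shattered[OF assms half_spaces_subset])
  also have "\<dots> \<le> card {S \<in> Pow I. card S \<le> D}"
    using assms card_shattered_half_spaces[OF assms] by (intro card_mono) auto
  also have "\<dots> \<le> (card I + 1) ^ D" by (rule card_subsets_card_le[OF assms])
  finally show ?thesis .
qed

section \<open>Sign patterns of ReLU networks\<close>

text \<open>\<open>r\<close> is the number of hidden layers, hence the length \<open>Suc r\<close>.
  With depth and width as the only constraints, the family is stable under shifting the output,
  rounding the parameters and, up to the input dimension, merging a matrix into the first
  layer.\<close>

definition relu_nets :: "nat \<Rightarrow> nat \<Rightarrow> nat \<Rightarrow> relu_params set" where
  "relu_nets k r N = {\<Theta>. wf_params k \<Theta> \<and> length \<Theta> \<le> Suc r \<and> max_width \<Theta> \<le> N}"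

lemma dim_relu_vec [simp]: "dim_vec (relu_vec v) = dim_vec v"
  by (simp add: relu_vec_def)

lemma index_relu_vec [simp]: "i < dim_vec v \<Longrightarrow> vec_index (relu_vec v) i = max (vec_index v i) 0"
  by (simp add: relu_vec_def)

lemma index_affine:
  assumes "i < dim_row W" "dim_vec b = dim_row W" "v \<in> carrier_vec (dim_col W)"
  shows "vec_index (W *\<^sub>v v + b) i = (\<Sum>j<dim_col W. W $$ (i, j) * vec_index v j) + vec_index b i"
  using assms by (simp add: scalar_prod_def lessThan_atLeast0)

lemma max_width_le_iff:
  "max_width \<Theta> \<le> N \<longleftrightarrow> (\<forall>l\<in>set (butlast \<Theta>). dim_row (fst l) \<le> N)"
  by (simp add: max_width_def case_prod_unfold)

lemma max_width_cong:
  assumes "map (dim_row \<circ> fst) \<Theta> = map (dim_row \<circ> fst) \<Theta>'"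
  shows "max_width \<Theta> = max_width \<Theta>'"
proof -
  have "(\<lambda>(W, b). dim_row W) ` set (butlast \<Theta>) = set (butlast (map (dim_row \<circ> fst) \<Theta>))" for \<Theta> :: relu_params
    by (simp add: map_butlast[symmetric] case_prod_unfold comp_def)
  then show ?thesis using assms by (simp add: max_width_def)
qed

section \<open>Affine maps of the output and linear maps of the input\<close>

fun affine_last :: "real \<Rightarrow> real \<Rightarrow> relu_params \<Rightarrow> relu_params" where
  "affine_last c e [] = []"
| "affine_last c e [(W, b)] = [(c \<cdot>\<^sub>m W, map_vec (\<lambda>t. c * t + e) b)]"
| "affine_last c e (l # l' # \<Theta>) = l # affine_last c e (l' # \<Theta>)"

lemma length_affine_last [simp]: "length (affine_last c e \<Theta>) = length \<Theta>"
  by (induction c e \<Theta> rule: affine_last.induct) auto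

lemma max_width_affine_last [simp]: "max_width (affine_last c e \<Theta>) = max_width \<Theta>"
proof (rule max_width_cong)
  show "map (dim_row \<circ> fst) (affine_last c e \<Theta>) = map (dim_row \<circ> fst) \<Theta>"
    by (induction c e \<Theta> rule: affine_last.induct) auto
qed

lemma affine_last_eq_Nil_iff [simp]: "affine_last c e \<Theta> = [] \<longleftrightarrow> \<Theta> = []"
  by (induction c e \<Theta> rule: affine_last.induct) auto

lemma wf_params_affine_last [simp]: "wf_params k (affine_last c e \<Theta>) = wf_params k \<Theta>"
proof (induction k \<Theta> rule: wf_params.induct)
  case (3 k W b l \<Theta>)
  obtain l' \<Theta>' where eq: "affine_last c e (l # \<Theta>) = l' # \<Theta>'"
    by (cases "affine_last c e (l # \<Theta>)") auto
  show ?case using 3 by (simp add: eq)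
qed auto

text \<open>Serves two purposes: \<open>e = 0\<close> with a small \<open>c\<close> shrinks the
  output into the student's range, and \<open>c = 1\<close> with a small \<open>e\<close> moves the
  outputs away from zero.\<close>

lemma net_eval_affine_last:
  assumes "wf_params k \<Theta>" and "v \<in> carrier_vec k"
  shows "vec_index (net_eval (affine_last c e \<Theta>) v) 0 = c * vec_index (net_eval \<Theta> v) 0 + e"
  using assms
proof (induction k \<Theta> arbitrary: v rule: wf_params.induct)
  case (2 k W b)
  have "vec_index ((c \<cdot>\<^sub>m W) *\<^sub>v v + map_vec (\<lambda>t. c * t + e) b) 0 =
      (\<Sum>j<k. (c * W $$ (0, j)) * vec_index v j) + (c * vec_index b 0 + e)"
    using 2 by (subst index_affine) simp_all
  also have "\<dots> = c * ((\<Sum>j<k. W $$ (0, j) * vec_index v j) + vec_index b 0) + e"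
    by (simp only: sum_distrib_left mult.assoc distrib_left add.assoc)
  also have "(\<Sum>j<k. W $$ (0, j) * vec_index v j) + vec_index b 0 = vec_index (W *\<^sub>v v + b) 0"
    using 2 by (subst index_affine) simp_all
  finally show ?case by (simp only: affine_last.simps net_eval.simps)
next
  case (3 k W b l \<Theta>)
  let ?v = "relu_vec (W *\<^sub>v v + b)"
  have v: "?v \<in> carrier_vec (dim_row W)" using 3(2) by (intro carrier_vecI) simp
  have wf: "wf_params (dim_row W) (l # \<Theta>)" using 3(2) by simp
  obtain l' \<Theta>' where eq: "affine_last c e (l # \<Theta>) = l' # \<Theta>'"
    by (cases "affine_last c e (l # \<Theta>)") auto
  show ?case using 3(1)[OF wf v] by (simp only: affine_last.simps eq net_eval.simps)
qed auto

lemma norm0_affine_last: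
  assumes "c \<noteq> 0"
  shows "norm0_params (affine_last c 0 \<Theta>) = norm0_params \<Theta>"
proof (induction \<Theta> rule: induct_list012)
  case (2 l)
  obtain W b where l: "l = (W, b)" by force
  have "{(i, j). i < dim_row W \<and> j < dim_col W \<and> (c \<cdot>\<^sub>m W) $$ (i, j) \<noteq> 0} =
      {(i, j). i < dim_row W \<and> j < dim_col W \<and> W $$ (i, j) \<noteq> 0}"
    using assms by auto
  moreover have "{i. i < dim_vec b \<and> vec_index (map_vec (\<lambda>t. c * t + 0) b) i \<noteq> 0} =
      {i. i < dim_vec b \<and> vec_index b i \<noteq> 0}"
    using assms by auto
  ultimately show ?case by (simp add: norm0_params_def l)
qed (auto simp: norm0_params_def)

lemma norm_inf_affine_last:
  assumes "0 < c" and "c \<le> 1" and "0 < k" and "wf_params k \<Theta>"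
  shows "norm_inf_params (affine_last c 0 \<Theta>) \<le> norm_inf_params \<Theta>"
proof -
  let ?E = "\<lambda>\<Theta>. \<Union>(W, b)\<in>set \<Theta>. elements_mat W \<union> vec_set b"
  have fin: "finite (?E \<Theta>)" for \<Theta> :: relu_params
    by (auto simp: elements_mat_def vec_set_def)
  have small: "\<exists>s\<in>?E \<Theta>. \<bar>t\<bar> \<le> \<bar>s\<bar>" if "t \<in> ?E (affine_last c 0 \<Theta>)" for t
    using that
  proof (induction \<Theta> rule: induct_list012)
    case (2 l)
    obtain W b where l: "l = (W, b)" by force
    have "\<bar>c * s\<bar> \<le> \<bar>s\<bar>" for s using assms(1,2) by (simp add: abs_mult mult_left_le_one_le)
    then show ?case using 2 by (auto simp: l elements_mat_def vec_set_def)
  qed (auto simp: case_prod_unfold)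
  \<comment> \<open>\<open>Max\<close> of an empty set is unspecified, so the set of parameters must
    be shown to be nonempty; a bias entry always supplies an element.\<close>
  have ne: "?E \<Theta> \<noteq> {}" if "wf_params k \<Theta>" for \<Theta>
    using that \<open>0 < k\<close>
    by (induction k \<Theta> rule: wf_params.induct) (auto simp: vec_set_def)
  show ?thesis
    unfolding norm_inf_params_def
  proof (rule Max.boundedI)
    show "finite (abs ` ?E (affine_last c 0 \<Theta>))" by (intro finite_imageI fin)
    have "?E (affine_last c 0 \<Theta>) \<noteq> {}" by (rule ne) (simp add: assms)
    then show "abs ` ?E (affine_last c 0 \<Theta>) \<noteq> {}" by (simp only: image_is_empty not_False_eq_True)
    fix u assume "u \<in> abs ` ?E (affine_last c 0 \<Theta>)"
    then obtain t where t: "u = \<bar>t\<bar>" "t \<in> ?E (affine_last c 0 \<Theta>)" by (rule imageE)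
    obtain s where s: "s \<in> ?E \<Theta>" "\<bar>t\<bar> \<le> \<bar>s\<bar>" using small[OF t(2)] by (rule bexE)
    have "\<bar>s\<bar> \<le> Max (abs ` ?E \<Theta>)" by (intro Max_ge finite_imageI fin imageI s(1))
    then show "u \<le> Max (abs ` ?E \<Theta>)" using s(2) t(1) by linarith
  qed
qed

fun absorb_first :: "real mat \<Rightarrow> relu_params \<Rightarrow> relu_params" where
  "absorb_first U [] = []"
| "absorb_first U ((W, b) # \<Theta>) = (W * U, b) # \<Theta>"

lemma net_eval_absorb_first:
  assumes "wf_params (dim_row U) \<Theta>" and "v \<in> carrier_vec (dim_col U)"
  shows "net_eval (absorb_first U \<Theta>) v = net_eval \<Theta> (U *\<^sub>v v)"
proof (cases \<Theta>)
  case (Cons l \<Theta>')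
  obtain W b where l: "l = (W, b)" by force
  have eq: "dim_col W = dim_row U" using assms(1) unfolding Cons l by (cases \<Theta>') auto
  have "W \<in> carrier_mat (dim_row W) (dim_row U)" by (rule carrier_matI[OF refl eq])
  moreover have "U \<in> carrier_mat (dim_row U) (dim_col U)" by (rule carrier_matI[OF refl refl])
  ultimately have "(W * U) *\<^sub>v v = W *\<^sub>v (U *\<^sub>v v)"
    using assms(2) by (rule assoc_mult_mat_vec)
  then show ?thesis unfolding Cons l by (cases \<Theta>') (simp_all only: absorb_first.simps net_eval.simps)
qed (use assms(1) in simp)

lemma absorb_first_relu_nets:
  assumes "\<Theta> \<in> relu_nets (dim_row U) r N"
  shows "absorb_first U \<Theta> \<in> relu_nets (dim_col U) r N"
proof -
  have *: "wf_params (dim_row U) \<Theta>" "length \<Theta> \<le> Suc r" "max_width \<Theta> \<le> N"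
    using assms by (auto simp: relu_nets_def)
  show ?thesis
  proof (cases \<Theta>)
    case (Cons l \<Theta>')
    obtain W b where l: "l = (W, b)" by force
    have "max_width (absorb_first U \<Theta>) = max_width \<Theta>"
      by (rule max_width_cong) (simp add: Cons l)
    then show ?thesis using * unfolding relu_nets_def Cons l by (cases \<Theta>') auto
  qed (use * in auto)
qed

text \<open>
  Entry \<open>m\<close> of the features belongs to neuron \<open>m div (n + 1)\<close> and input coordinate
  \<open>m mod (n + 1)\<close>, where the extra coordinate \<open>n\<close> is constant and carries the bias.
\<close>

definition gated_features :: "nat \<Rightarrow> nat set \<Rightarrow> real Matrix.vec \<Rightarrow> real Matrix.vec" where
  "gated_features k S v = (let n = dim_vec v in Matrix.vec (k * Suc n)
     (\<lambda>m. if m div Suc n \<in> S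
       then if m mod Suc n < n then vec_index v (m mod Suc n) else 1 else 0))"

text \<open>Row \<open>j\<close> lives in block \<open>j\<close> only, where it holds row
  \<open>j\<close> of \<open>W\<close> followed by its bias. The matrix does not depend on the
  activation pattern, which is carried entirely by the features; hence one matrix serves all sample
  points.\<close>

definition gated_weights :: "real mat \<Rightarrow> real Matrix.vec \<Rightarrow> real mat" where
  "gated_weights W b = (let n = dim_col W in Matrix.mat (dim_row W) (dim_row W * Suc n)
     (\<lambda>(j, m). if m div Suc n = j
       then if m mod Suc n < n then W $$ (j, m mod Suc n) else vec_index b j else 0))"

lemma gated_weights_mult_features:
  assumes v: "v \<in> carrier_vec (dim_col W)" and b: "dim_vec b = dim_row W"
    and S: "\<And>j. j < dim_row W \<Longrightarrow> j \<in> S \<longleftrightarrow> 0 \<le> vec_index (W *\<^sub>v v + b) j"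
  shows "gated_weights W b *\<^sub>v gated_features (dim_row W) S v = relu_vec (W *\<^sub>v v + b)"
proof (rule eq_vecI)
  define n where "n = dim_col W"
  define s where "s = Suc n"
  have n: "dim_vec v = n" "dim_col W = n" using v by (simp_all add: n_def)
  have s: "0 < s" by (simp add: s_def)
  fix j assume "j < dim_vec (relu_vec (W *\<^sub>v v + b))"
  then have j: "j < dim_row W" using b by simp
  define h where "h m = (if m div s = j
      then if m mod s < n then W $$ (j, m mod s) else vec_index b j else 0) *
    (if m div s \<in> S then if m mod s < n then vec_index v (m mod s) else 1 else 0)" for m
  have dm: "(m + i * s) div s = i" "(m + i * s) mod s = m" if "m < s" for m i
    using that by simp_all
  have "vec_index (gated_weights W b *\<^sub>v gated_features (dim_row W) S v) j =
      (\<Sum>m<dim_row W * s. h m)"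
    using j unfolding h_def s_def
    by (simp add: scalar_prod_def gated_weights_def gated_features_def Let_def n lessThan_atLeast0)
  \<comment> \<open>The feature index is split into blocks of length \<open>s\<close>, one per
    neuron; block \<open>j\<close> alone meets the support of row \<open>j\<close>.\<close>
  also have "\<dots> = (\<Sum>i<dim_row W. \<Sum>m=i * s..<i * s + s. h m)"
    by (rule sum.nat_group[symmetric])
  also have "\<dots> = (\<Sum>i<dim_row W. \<Sum>m<s. h (m + i * s))"
    using sum.shift_bounds_nat_ivl[of h 0 _ s]
    by (simp add: lessThan_atLeast0 add.commute[of s] add.commute[of _ "_ * s"])
  also have "\<dots> = (\<Sum>i<dim_row W. if i = j then \<Sum>m<s. h (m + j * s) else 0)"
    by (intro sum.cong refl) (auto simp: h_def dm)
  also have "\<dots> = (\<Sum>m<s. h (m + j * s))"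
    using j by simp
  also have "\<dots> = (\<Sum>m<s. (if m < n then W $$ (j, m) else vec_index b j) *
      (if j \<in> S then if m < n then vec_index v m else 1 else 0))"
    by (intro sum.cong refl) (auto simp: h_def dm)
  also have "\<dots> = (if j \<in> S then vec_index (W *\<^sub>v v + b) j else 0)"
    using j b v by (subst index_affine) (simp_all add: s_def n)
  also have "\<dots> = vec_index (relu_vec (W *\<^sub>v v + b)) j"
    using S[OF j] j b by (simp add: max_def)
  finally show "vec_index (gated_weights W b *\<^sub>v gated_features (dim_row W) S v) j =
      vec_index (relu_vec (W *\<^sub>v v + b)) j" .
qed (use b in \<open>simp add: gated_weights_def Let_def\<close>)

section \<open>Counting sign patterns layer by layer\<close>

definition sign_patterns ::
    "nat \<Rightarrow> nat \<Rightarrow> nat \<Rightarrow> ('i \<Rightarrow> real Matrix.vec) \<Rightarrow> 'i set \<Rightarrow> 'i set set" where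
  "sign_patterns n r N \<phi> I =
     (\<lambda>\<Theta>. {i \<in> I. 0 \<le> vec_index (net_eval \<Theta> (\<phi> i)) 0}) ` relu_nets n r N"

lemma sign_patterns_subset: "sign_patterns n r N \<phi> I \<subseteq> Pow I"
  by (auto simp: sign_patterns_def)

lemma finite_sign_patterns: "finite I \<Longrightarrow> finite (sign_patterns n r N \<phi> I)"
  by (rule finite_subset[OF sign_patterns_subset]) simp

lemma affine_pattern_in_half_spaces:
  assumes "\<And>i. i \<in> I \<Longrightarrow> \<phi> i \<in> carrier_vec (dim_col W)" and "dim_vec b = dim_row W" and "j < dim_row W"
  shows "{i \<in> I. 0 \<le> vec_index (W *\<^sub>v \<phi> i + b) j} \<in>
    half_spaces (Suc (dim_col W)) (\<lambda>i m. if m < dim_col W then vec_index (\<phi> i) m else 1) I"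
  unfolding half_spaces_def
proof (rule rev_image_eqI[OF UNIV_I])
  let ?w = "\<lambda>m. if m < dim_col W then W $$ (j, m) else vec_index b j"
  show "{i \<in> I. 0 \<le> vec_index (W *\<^sub>v \<phi> i + b) j} = {i \<in> I. 0 \<le> (\<Sum>m<Suc (dim_col W).
      ?w m * (if m < dim_col W then vec_index (\<phi> i) m else 1))}"
    using assms by (intro Collect_cong conj_cong refl) (simp only: index_affine, simp)
qed

lemma sign_patterns_0:
  assumes "\<And>i. i \<in> I \<Longrightarrow> \<phi> i \<in> carrier_vec n" and "wf_params n [(W, b)]"
  shows "{i \<in> I. 0 \<le> vec_index (net_eval [(W, b)] (\<phi> i)) 0} \<in>
    half_spaces (Suc n) (\<lambda>i m. if m < n then vec_index (\<phi> i) m else 1) I"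
  using affine_pattern_in_half_spaces[of I \<phi> W b 0] assms by simp

text \<open>
  Once the activation pattern of the first layer is fixed on \<open>I\<close>, the output of that layer is linear
  in the gated features, and the linear map can be merged into the weights of the next layer.
\<close>

lemma sign_patterns_Suc_subset:
  assumes "\<And>i. i \<in> I \<Longrightarrow> \<phi> i \<in> carrier_vec n"
  defines "H \<equiv> half_spaces (Suc n) (\<lambda>i m. if m < n then vec_index (\<phi> i) m else 1) I"
  shows "sign_patterns n (Suc r) N \<phi> I \<subseteq> H \<union> (\<Union>k\<in>{1..N}. \<Union>a\<in>{..<k} \<rightarrow>\<^sub>E H.
    sign_patterns (k * Suc n) r N (\<lambda>i. gated_features k {j. j < k \<and> i \<in> a j} (\<phi> i)) I)"
proof
  fix J assume "J \<in> sign_patterns n (Suc r) N \<phi> I"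
  then obtain \<Theta> where \<Theta>: "\<Theta> \<in> relu_nets n (Suc r) N"
    and J: "J = {i \<in> I. 0 \<le> vec_index (net_eval \<Theta> (\<phi> i)) 0}"
    by (auto simp: sign_patterns_def)
  have wf: "wf_params n \<Theta>" using \<Theta> by (simp add: relu_nets_def)
  show "J \<in> H \<union> (\<Union>k\<in>{1..N}. \<Union>a\<in>{..<k} \<rightarrow>\<^sub>E H.
    sign_patterns (k * Suc n) r N (\<lambda>i. gated_features k {j. j < k \<and> i \<in> a j} (\<phi> i)) I)"
  proof (cases "(n, \<Theta>)" rule: wf_params.cases)
    case (2 k W b)
    then have "\<Theta> = [(W, b)]" by simp
    then have "J \<in> H" using sign_patterns_0[of I \<phi> n W b] assms wf by (simp only: J H_def)
    then show ?thesis by simp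
  next
    case (3 k0 W b l \<Theta>')
    then have eq: "\<Theta> = (W, b) # l # \<Theta>'" by simp
    define k where "k = dim_row W"
    have d: "0 < k" "dim_col W = n" "dim_vec b = k" "wf_params k (l # \<Theta>')"
      using wf unfolding eq k_def by auto
    have kN: "k \<le> N" using \<Theta> unfolding relu_nets_def eq k_def by (simp add: max_width_le_iff)
    have net: "l # \<Theta>' \<in> relu_nets k r N"
      using \<Theta> d unfolding relu_nets_def eq by (simp add: max_width_le_iff)
    \<comment> \<open>The restriction puts the tuple of activation patterns into the extensional
      function space, whose cardinality is \<open>card H ^ k\<close>.\<close>
    define a where "a = (\<lambda>j\<in>{..<k}. {i \<in> I. 0 \<le> vec_index (W *\<^sub>v \<phi> i + b) j})"
    have a: "a \<in> {..<k} \<rightarrow>\<^sub>E H"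
      unfolding a_def
    proof (rule restrict_PiE_iff[THEN iffD2], rule ballI)
      fix j assume "j \<in> {..<k}"
      then show "{i \<in> I. 0 \<le> vec_index (W *\<^sub>v \<phi> i + b) j} \<in> H"
        using affine_pattern_in_half_spaces[of I \<phi> W b j] assms(1) d by (simp add: k_def H_def)
    qed
    define U where "U = gated_weights W b"
    have U: "dim_row U = k" "dim_col U = k * Suc n"
      by (simp_all add: U_def gated_weights_def Let_def k_def d)
    let ?\<psi> = "\<lambda>i. gated_features k {j. j < k \<and> i \<in> a j} (\<phi> i)"
    have "net_eval (absorb_first U (l # \<Theta>')) (?\<psi> i) = net_eval \<Theta> (\<phi> i)" if i: "i \<in> I" for i
    proof -
      have c: "\<phi> i \<in> carrier_vec n" using assms(1) i by simp
      have "?\<psi> i \<in> carrier_vec (dim_col U)"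
        using c by (intro carrier_vecI) (simp add: gated_features_def Let_def U)
      then have "net_eval (absorb_first U (l # \<Theta>')) (?\<psi> i) = net_eval (l # \<Theta>') (U *\<^sub>v ?\<psi> i)"
        using d by (intro net_eval_absorb_first) (auto simp: U)
      also have "U *\<^sub>v ?\<psi> i = relu_vec (W *\<^sub>v \<phi> i + b)"
        unfolding U_def k_def using c d i
        by (intro gated_weights_mult_features) (auto simp: a_def k_def)
      finally show ?thesis by (simp add: eq)
    qed
    then have "J = {i \<in> I. 0 \<le> vec_index (net_eval (absorb_first U (l # \<Theta>')) (?\<psi> i)) 0}"
      unfolding J by (intro Collect_cong conj_cong refl) simp
    moreover have "absorb_first U (l # \<Theta>') \<in> relu_nets (k * Suc n) r N"
      using absorb_first_relu_nets[of "l # \<Theta>'" U r N] net U by simp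
    ultimately have "J \<in> sign_patterns (k * Suc n) r N ?\<psi> I"
      unfolding sign_patterns_def by (rule image_eqI)
    moreover have "k \<in> {1..N}" using d kN by simp
    ultimately show ?thesis using a by (intro UnI2 UN_I) assumption+
  next
    case (1 k)
    then show ?thesis using wf by simp
  qed
qed

text \<open>Write \<open>q = card I + 1\<close> and \<open>A = (n + 1) * (N + 1)\<close>. The first
  layer has at most \<open>q ^ A\<close> activation patterns for each width, and the remaining
  network has input dimension at most \<open>N * (n + 1)\<close>, so \<open>n + 1\<close> is
  replaced by at most \<open>A\<close>. Another \<open>q ^ A\<close> pays for the choice of the
  width. Each layer thus adds \<open>2 * A\<close> to the exponent, whence the factor
  \<open>2 * r + 1\<close>.\<close>

lemma card_sign_patterns_le:
  assumes "finite I" and "I \<noteq> {}" and "\<And>i. i \<in> I \<Longrightarrow> \<phi> i \<in> carrier_vec n"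
  shows "card (sign_patterns n r N \<phi> I) \<le> (card I + 1) ^ ((n + 1) * (N + 1) ^ r * (2 * r + 1))"
  using assms(3)
proof (induction r arbitrary: n \<phi>)
  case 0
  let ?H = "half_spaces (Suc n) (\<lambda>i m. if m < n then vec_index (\<phi> i) m else 1) I"
  have "sign_patterns n 0 N \<phi> I \<subseteq> ?H"
  proof
    fix J assume "J \<in> sign_patterns n 0 N \<phi> I"
    then obtain \<Theta> where \<Theta>: "\<Theta> \<in> relu_nets n 0 N"
      and J: "J = {i \<in> I. 0 \<le> vec_index (net_eval \<Theta> (\<phi> i)) 0}"
      by (auto simp: sign_patterns_def)
    then obtain W b where "\<Theta> = [(W, b)]" "wf_params n \<Theta>"
      unfolding relu_nets_def by (cases "(n, \<Theta>)" rule: wf_params.cases) auto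
    then show "J \<in> ?H" using sign_patterns_0[of I \<phi> n W b] 0 by (simp only: J)
  qed
  then have "card (sign_patterns n 0 N \<phi> I) \<le> card ?H"
    using assms(1) by (intro card_mono finite_half_spaces)
  also have "\<dots> \<le> (card I + 1) ^ Suc n" by (rule card_half_spaces_le[OF assms(1)])
  finally show ?case by simp
next
  case (Suc r)
  define q where "q = card I + 1"
  have q: "2 \<le> q" using assms(1,2) by (simp add: q_def Suc_le_eq card_gt_0_iff)
  define H where "H = half_spaces (Suc n) (\<lambda>i m. if m < n then vec_index (\<phi> i) m else 1) I"
  define E where "E = (N * Suc n + 1) * (N + 1) ^ r * (2 * r + 1)"
  define A where "A = (n + 1) * (N + 1)"
  have finH: "finite H" unfolding H_def using assms(1) by (rule finite_half_spaces)
  have cH: "card H \<le> q ^ Suc n" unfolding H_def q_def by (rule card_half_spaces_le[OF assms(1)])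
  define P where "P k a = sign_patterns (k * Suc n) r N (\<lambda>i. gated_features k {j. j < k \<and> i \<in> a j} (\<phi> i)) I" for k a
  have finP: "finite (P k a)" for k a
    unfolding P_def using assms(1) by (rule finite_sign_patterns)
  have sub: "sign_patterns n (Suc r) N \<phi> I \<subseteq> H \<union> (\<Union>k\<in>{1..N}. \<Union>a\<in>{..<k} \<rightarrow>\<^sub>E H. P k a)"
    unfolding H_def P_def by (rule sign_patterns_Suc_subset[OF Suc.prems])
  have cP: "card (P k a) \<le> q ^ E" if k: "k \<in> {1..N}" for k a
  proof -
    have "card (P k a) \<le> q ^ ((k * Suc n + 1) * (N + 1) ^ r * (2 * r + 1))"
      unfolding P_def q_def using Suc.prems
      by (intro Suc.IH carrier_vecI) (simp add: gated_features_def Let_def)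
    also have "\<dots> \<le> q ^ E"
      unfolding E_def using q k
      by (intro power_increasing mult_le_mono add_le_mono order_refl) auto
    finally show ?thesis .
  qed
  have bound: "card (\<Union>a\<in>{..<k} \<rightarrow>\<^sub>E H. P k a) \<le> q ^ (A + E)" if k: "k \<in> {1..N}" for k
  proof -
    have "card (\<Union>a\<in>{..<k} \<rightarrow>\<^sub>E H. P k a) \<le> (\<Sum>a\<in>{..<k} \<rightarrow>\<^sub>E H. card (P k a))"
      using finH by (intro card_UN_le finite_PiE) auto
    also have "\<dots> \<le> card ({..<k} \<rightarrow>\<^sub>E H) * q ^ E"
      using sum_bounded_above[of "{..<k} \<rightarrow>\<^sub>E H" "\<lambda>a. card (P k a)" "q ^ E"] cP[OF k] by simp
    also have "\<dots> = card H ^ k * q ^ E"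
      by (simp add: card_PiE)
    also have "\<dots> \<le> (q ^ Suc n) ^ k * q ^ E"
      by (intro mult_le_mono1 power_mono cH) simp
    also have "\<dots> = q ^ (Suc n * k + E)" by (simp only: power_mult power_add)
    also have "\<dots> \<le> q ^ (A + E)"
    proof (rule power_increasing)
      have "Suc n * k \<le> Suc n * (N + 1)" using k by (intro mult_le_mono) auto
      then show "Suc n * k + E \<le> A + E" by (simp add: A_def)
    qed (use q in simp)
    finally show ?thesis .
  qed
  have "card (sign_patterns n (Suc r) N \<phi> I) \<le> card (H \<union> (\<Union>k\<in>{1..N}. \<Union>a\<in>{..<k} \<rightarrow>\<^sub>E H. P k a))"
    using sub finH finP by (intro card_mono) (auto intro!: finite_PiE)
  also have "\<dots> \<le> card H + card (\<Union>k\<in>{1..N}. \<Union>a\<in>{..<k} \<rightarrow>\<^sub>E H. P k a)"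
    by (rule card_Un_le)
  also have "\<dots> \<le> q ^ (A + E) + (\<Sum>k\<in>{1..N}. q ^ (A + E))"
  proof (rule add_mono)
    have "q ^ Suc n \<le> q ^ (A + E)" using q by (intro power_increasing) (auto simp: A_def)
    then show "card H \<le> q ^ (A + E)" using cH by simp
    show "card (\<Union>k\<in>{1..N}. \<Union>a\<in>{..<k} \<rightarrow>\<^sub>E H. P k a) \<le> (\<Sum>k\<in>{1..N}. q ^ (A + E))"
      by (rule order_trans[OF card_UN_le sum_mono]) (use bound in auto)
  qed
  also have "\<dots> = (N + 1) * q ^ (A + E)" by simp
  \<comment> \<open>\<open>N + 1\<close> counts the \<open>N\<close> possible first widths and the
    networks without hidden layer. It fits into \<open>q ^ A\<close> because \<open>q\<close> is at
    least 2, which is where \<open>I\<close> being nonempty enters.\<close>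
  also have "\<dots> \<le> q ^ A * q ^ (A + E)"
  proof (rule mult_le_mono1)
    have "N + 1 \<le> 2 ^ (N + 1)" by (rule less_imp_le[OF less_exp])
    also have "\<dots> \<le> q ^ (N + 1)" using q by (intro power_mono) auto
    also have "\<dots> \<le> q ^ A" using q by (intro power_increasing) (auto simp: A_def)
    finally show "N + 1 \<le> q ^ A" .
  qed
  also have "\<dots> = q ^ (2 * A + E)" by (simp add: power_add mult_2)
  also have "\<dots> \<le> q ^ ((n + 1) * (N + 1) ^ Suc r * (2 * Suc r + 1))"
  proof (rule power_increasing)
    have "1 \<le> (N + 1) ^ r" by simp
    then have "A * 1 \<le> A * (N + 1) ^ r" by (rule mult_le_mono2)
    moreover have "E \<le> A * (N + 1) ^ r * (2 * r + 1)"
      unfolding E_def A_def by (intro mult_le_mono) auto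
    ultimately have "2 * A + E \<le> 2 * (A * (N + 1) ^ r) + A * (N + 1) ^ r * (2 * r + 1)" by linarith
    also have "\<dots> = (n + 1) * (N + 1) ^ Suc r * (2 * Suc r + 1)"
      by (simp add: A_def algebra_simps)
    finally show "2 * A + E \<le> (n + 1) * (N + 1) ^ Suc r * (2 * Suc r + 1)" .
  qed (use q in simp)
  finally show ?case by (simp add: q_def)
qed

section \<open>Networks with rational parameters\<close>

definition map_params :: "(real \<Rightarrow> real) \<Rightarrow> relu_params \<Rightarrow> relu_params" where
  "map_params g \<Theta> = map (\<lambda>(W, b). (map_mat g W, map_vec g b)) \<Theta>"

lemma map_params_simps [simp]:
  "map_params g [] = []"
  "map_params g ((W, b) # \<Theta>) = (map_mat g W, map_vec g b) # map_params g \<Theta>"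
  by (simp_all add: map_params_def)

lemma wf_params_map_params [simp]: "wf_params k (map_params g \<Theta>) = wf_params k \<Theta>"
proof (induction k \<Theta> rule: wf_params.induct)
  case (3 k W b l \<Theta>)
  then show ?case by (cases l) simp
qed simp_all

lemma length_map_params [simp]: "length (map_params g \<Theta>) = length \<Theta>"
  by (simp add: map_params_def)

lemma max_width_map_params [simp]: "max_width (map_params g \<Theta>) = max_width \<Theta>"
  by (rule max_width_cong) (simp add: map_params_def case_prod_unfold)

lemma map_params_relu_nets: "\<Theta> \<in> relu_nets k r N \<Longrightarrow> map_params g \<Theta> \<in> relu_nets k r N"
  by (simp add: relu_nets_def)

lemma affine_last_relu_nets: "\<Theta> \<in> relu_nets k r N \<Longrightarrow> affine_last c e \<Theta> \<in> relu_nets k r N"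
  by (simp add: relu_nets_def)

text \<open>The input varies along with the parameters, since in the induction the later layers
  receive the perturbed output of the first one.\<close>

lemma tendsto_net_eval:
  assumes "wf_params k \<Theta>" and "\<And>t. (\<lambda>m. g m t) \<longlonglongrightarrow> t"
    and "\<And>m. v m \<in> carrier_vec k" and "u \<in> carrier_vec k"
    and "\<And>i. i < k \<Longrightarrow> (\<lambda>m. vec_index (v m) i) \<longlonglongrightarrow> vec_index u i"
  shows "(\<lambda>m. vec_index (net_eval (map_params (g m) \<Theta>) (v m)) 0) \<longlonglongrightarrow> vec_index (net_eval \<Theta> u) 0"
  using assms(1,3-)
proof (induction k \<Theta> arbitrary: v u rule: wf_params.induct)
  case (1 k)
  then show ?case by simp
next
  case (2 k W b)
  have d: "dim_row W = 1" "dim_col W = k" "dim_vec b = 1" using 2(1) by simp_all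
  have "(\<lambda>m. (\<Sum>j<k. g m (W $$ (0, j)) * vec_index (v m) j) + g m (vec_index b 0)) \<longlonglongrightarrow>
      (\<Sum>j<k. W $$ (0, j) * vec_index u j) + vec_index b 0"
    using 2(4) assms(2) by (intro tendsto_intros) auto
  moreover have "vec_index (map_mat (g m) W *\<^sub>v v m + map_vec (g m) b) 0 =
      (\<Sum>j<k. g m (W $$ (0, j)) * vec_index (v m) j) + g m (vec_index b 0)" for m
    using 2(2) d by (subst index_affine) simp_all
  moreover have "vec_index (W *\<^sub>v u + b) 0 = (\<Sum>j<k. W $$ (0, j) * vec_index u j) + vec_index b 0"
    using 2(3) d by (subst index_affine) simp_all
  ultimately show ?case by (simp only: map_params_simps net_eval.simps)
next
  case (3 k W b l \<Theta>)
  obtain W' b' where l: "l = (W', b')" by force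
  have d: "dim_col W = k" "dim_vec b = dim_row W" "wf_params (dim_row W) (l # \<Theta>)"
    using 3(2) by simp_all
  have lim: "(\<lambda>m. vec_index (relu_vec (map_mat (g m) W *\<^sub>v v m + map_vec (g m) b)) i) \<longlonglongrightarrow>
      vec_index (relu_vec (W *\<^sub>v u + b)) i" if i: "i < dim_row W" for i
  proof -
    have "(\<lambda>m. max ((\<Sum>j<k. g m (W $$ (i, j)) * vec_index (v m) j) + g m (vec_index b i)) 0) \<longlonglongrightarrow>
        max ((\<Sum>j<k. W $$ (i, j) * vec_index u j) + vec_index b i) 0"
      using 3(5) assms(2) by (intro tendsto_intros) auto
    moreover have "vec_index (map_mat (g m) W *\<^sub>v v m + map_vec (g m) b) i =
        (\<Sum>j<k. g m (W $$ (i, j)) * vec_index (v m) j) + g m (vec_index b i)" for m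
      using 3(3)[of m] d i by (subst index_affine) simp_all
    moreover have "vec_index (W *\<^sub>v u + b) i = (\<Sum>j<k. W $$ (i, j) * vec_index u j) + vec_index b i"
      using 3(4) d i by (subst index_affine) simp_all
    ultimately show ?thesis using i d by simp
  qed
  have "(\<lambda>m. vec_index (net_eval (map_params (g m) (l # \<Theta>))
      (relu_vec (map_mat (g m) W *\<^sub>v v m + map_vec (g m) b))) 0) \<longlonglongrightarrow>
    vec_index (net_eval (l # \<Theta>) (relu_vec (W *\<^sub>v u + b))) 0"
    using d lim by (intro 3(1) carrier_vecI) simp_all
  then show ?case by (simp add: l)
qed

section \<open>Measurability in the input\<close>

lemma borel_measurable_net_eval:
  assumes "wf_params k \<Theta>" and "\<And>x. v x \<in> carrier_vec k"
    and "\<And>i. i < k \<Longrightarrow> (\<lambda>x. vec_index (v x) i) \<in> borel_measurable M"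
  shows "(\<lambda>x. vec_index (net_eval \<Theta> (v x)) 0) \<in> borel_measurable M"
  using assms
proof (induction k \<Theta> arbitrary: v rule: wf_params.induct)
  case (1 k)
  then show ?case by simp
next
  case (2 k W b)
  have d: "dim_row W = 1" "dim_col W = k" "dim_vec b = 1" using 2(1) by simp_all
  have "(\<lambda>x. (\<Sum>j<k. W $$ (0, j) * vec_index (v x) j) + vec_index b 0) \<in> borel_measurable M"
    using 2(3) by (intro borel_measurable_add borel_measurable_sum borel_measurable_times borel_measurable_const) auto
  moreover have "vec_index (W *\<^sub>v v x + b) 0 = (\<Sum>j<k. W $$ (0, j) * vec_index (v x) j) + vec_index b 0" for x
    using 2(2)[of x] d by (subst index_affine) simp_all
  ultimately show ?case by (simp only: net_eval.simps)
next
  case (3 k W b l \<Theta>)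
  have d: "dim_col W = k" "dim_vec b = dim_row W" "wf_params (dim_row W) (l # \<Theta>)"
    using 3(2) by simp_all
  have meas: "(\<lambda>x. vec_index (relu_vec (W *\<^sub>v v x + b)) i) \<in> borel_measurable M" if i: "i < dim_row W" for i
  proof -
    have "(\<lambda>x. max ((\<Sum>j<k. W $$ (i, j) * vec_index (v x) j) + vec_index b i) 0) \<in> borel_measurable M"
      using 3(4) by (intro borel_measurable_max borel_measurable_add borel_measurable_sum borel_measurable_times borel_measurable_const) auto
    moreover have "vec_index (W *\<^sub>v v x + b) i =
        (\<Sum>j<k. W $$ (i, j) * vec_index (v x) j) + vec_index b i" for x
      using 3(3)[of x] d i by (subst index_affine) simp_all
    ultimately show ?thesis using i d by simp
  qed
  have "(\<lambda>x. vec_index (net_eval (l # \<Theta>) (relu_vec (W *\<^sub>v v x + b))) 0) \<in> borel_measurable M"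
    using d meas by (intro 3(1) carrier_vecI) simp_all
  then show ?case by simp
qed

lemma input_vec_carrier [simp]: "input_vec x \<in> carrier_vec CARD('d)" for x :: "real ^ 'd"
  by (intro carrier_vecI) (simp add: input_vec_def)

lemma borel_measurable_net_fun:
  fixes \<Theta> :: relu_params
  assumes "wf_params CARD('d) \<Theta>"
  shows "(net_fun \<Theta> :: real ^ 'd \<Rightarrow> real) \<in> borel_measurable borel"
proof -
  have "(\<lambda>x. vec_index (net_eval \<Theta> (input_vec x)) 0) \<in> borel_measurable (borel :: (real ^ 'd) measure)"
  proof (rule borel_measurable_net_eval[OF assms])
    fix i assume "i < CARD('d)"
    then show "(\<lambda>x. vec_index (input_vec (x :: real ^ 'd)) i) \<in> borel_measurable borel"
      by (simp add: input_vec_def)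
  qed simp
  then show ?thesis by (simp add: net_fun_def[abs_def])
qed

text \<open>The codes form a countable type, which makes the range countable. Codes of the wrong
  shape are harmless, as the range is later intersected with \<open>relu_nets\<close>.\<close>

definition decode_params :: "(nat \<times> rat list list \<times> rat list) list \<Rightarrow> relu_params" where
  "decode_params cs = map (\<lambda>(n, rs, b).
     (mat_of_rows_list n (map (map of_rat) rs), vec_of_list (map of_rat b))) cs"

definition grid_rat :: "nat \<Rightarrow> real \<Rightarrow> rat" where
  "grid_rat m t = of_int \<lfloor>t * real (Suc m)\<rfloor> / of_nat (Suc m)"

lemma grid_rat_tendsto: "(\<lambda>m. real_of_rat (grid_rat m t)) \<longlonglongrightarrow> t"
proof (rule LIMSEQ_I)
  fix e :: real assume e: "0 < e"
  obtain m0 where m0: "inverse (real (Suc m0)) < e" using reals_Archimedean[OF e] by auto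
  have "norm (real_of_rat (grid_rat m t) - t) < e" if "m0 \<le> m" for m
  proof -
    have p: "0 < real (Suc m)" by simp
    have eq: "real_of_rat (grid_rat m t) = of_int \<lfloor>t * real (Suc m)\<rfloor> / real (Suc m)"
      by (simp add: grid_rat_def of_rat_divide del: of_nat_Suc)
    have "\<bar>of_int \<lfloor>t * real (Suc m)\<rfloor> - t * real (Suc m)\<bar> \<le> 1" by linarith
    then have "\<bar>of_int \<lfloor>t * real (Suc m)\<rfloor> - t * real (Suc m)\<bar> / real (Suc m) \<le> 1 / real (Suc m)"
      using p by (intro divide_right_mono) simp_all
    moreover have "of_int \<lfloor>t * real (Suc m)\<rfloor> / real (Suc m) - t =
        (of_int \<lfloor>t * real (Suc m)\<rfloor> - t * real (Suc m)) / real (Suc m)"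
      using p by (simp add: diff_divide_distrib del: of_nat_Suc)
    ultimately have "\<bar>of_int \<lfloor>t * real (Suc m)\<rfloor> / real (Suc m) - t\<bar> \<le> 1 / real (Suc m)"
      using p by (simp only: abs_divide)
    also have "\<dots> \<le> inverse (real (Suc m0))" using that by (simp add: field_simps)
    finally show ?thesis using m0 by (simp add: eq)
  qed
  then show "\<exists>m0. \<forall>m\<ge>m0. norm (real_of_rat (grid_rat m t) - t) < e" by blast
qed

lemma grid_params_in_range: "map_params (\<lambda>t. of_rat (grid_rat m t)) \<Theta> \<in> range decode_params"
proof -
  have 1: "mat_of_rows_list (dim_col W) (map (map of_rat)
      (map (\<lambda>i. map (\<lambda>j. grid_rat m (W $$ (i, j))) [0..<dim_col W]) [0..<dim_row W])) =
    map_mat (\<lambda>t. of_rat (grid_rat m t)) W" for W :: "real mat"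
    by (rule eq_matI) (simp_all add: mat_of_rows_list_def)
  have 2: "vec_of_list (map of_rat (map (\<lambda>i. grid_rat m (vec_index b i)) [0..<dim_vec b])) =
    map_vec (\<lambda>t. of_rat (grid_rat m t)) b" for b :: "real Matrix.vec"
    by (rule eq_vecI) (simp_all add: vec_of_list_index)
  have "decode_params (map (\<lambda>(W, b). (dim_col W,
      map (\<lambda>i. map (\<lambda>j. grid_rat m (W $$ (i, j))) [0..<dim_col W]) [0..<dim_row W],
      map (\<lambda>i. grid_rat m (vec_index b i)) [0..<dim_vec b])) \<Theta>) =
    map_params (\<lambda>t. of_rat (grid_rat m t)) \<Theta>"
    unfolding decode_params_def map_params_def list.map_comp
    by (intro list.map_cong refl) (simp only: comp_def case_prod_unfold fst_conv snd_conv 1 2)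
  from this[symmetric] show ?thesis by (rule range_eqI)
qed

definition rational_nets :: "nat \<Rightarrow> nat \<Rightarrow> nat \<Rightarrow> relu_params set" where
  "rational_nets k r N = relu_nets k r N \<inter> range decode_params"

lemma countable_rational_nets: "countable (rational_nets k r N)"
  by (simp add: rational_nets_def countable_Int2)

text \<open>
  Raising the output bias slightly makes all outputs on \<open>I\<close> nonzero without changing the sign
  pattern, which is then stable under small perturbations of the parameters.
\<close>

lemma sign_pattern_rational:
  assumes "\<Theta> \<in> relu_nets k r N" and "finite I" and "\<And>i. i \<in> I \<Longrightarrow> \<phi> i \<in> carrier_vec k"
  shows "\<exists>\<Theta>'\<in>rational_nets k r N.
    \<forall>i\<in>I. 0 \<le> vec_index (net_eval \<Theta>' (\<phi> i)) 0 \<longleftrightarrow> 0 \<le> vec_index (net_eval \<Theta> (\<phi> i)) 0"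
proof -
  define h where "h i = vec_index (net_eval \<Theta> (\<phi> i)) 0" for i
  define g :: "nat \<Rightarrow> real \<Rightarrow> real" where "g m t = of_rat (grid_rat m t)" for m t
  obtain e where e: "0 < e" "\<And>i. i \<in> I \<Longrightarrow> h i < 0 \<Longrightarrow> h i + e < 0"
  proof -
    have "\<forall>\<^sub>F e in at_right 0. \<forall>i\<in>{i \<in> I. h i < 0}. h i + e < 0"
    proof (rule eventually_ball_finite)
      show "\<forall>i\<in>{i \<in> I. h i < 0}. \<forall>\<^sub>F e in at_right 0. h i + e < 0"
      proof
        fix i assume i: "i \<in> {i \<in> I. h i < 0}"
        have "\<forall>\<^sub>F e in at_right 0. e < - h i"
          by (rule eventually_at_right_real[THEN eventually_mono]) (use i in auto)
        then show "\<forall>\<^sub>F e in at_right 0. h i + e < 0" by eventually_elim simp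
      qed
    qed (use assms(2) in simp)
    then have "\<forall>\<^sub>F e in at_right 0. 0 < e \<and> (\<forall>i\<in>{i \<in> I. h i < 0}. h i + e < 0)"
      using eventually_at_right_less by (rule eventually_elim2) auto
    then obtain e where "0 < e" "\<forall>i\<in>{i \<in> I. h i < 0}. h i + e < 0"
      using eventually_happens'[OF trivial_limit_at_right_real] by blast
    then show ?thesis using that by auto
  qed
  let ?\<Theta>1 = "affine_last 1 e \<Theta>"
  have wf: "wf_params k \<Theta>" using assms(1) by (simp add: relu_nets_def)
  have ev: "\<forall>\<^sub>F m in sequentially. 0 \<le> vec_index (net_eval (map_params (g m) ?\<Theta>1) (\<phi> i)) 0 \<longleftrightarrow> 0 \<le> h i"
    if i: "i \<in> I" for i
  proof -
    have "(\<lambda>m. vec_index (net_eval (map_params (g m) ?\<Theta>1) (\<phi> i)) 0) \<longlonglongrightarrow>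
        vec_index (net_eval ?\<Theta>1 (\<phi> i)) 0"
      using wf assms(3)[OF i] by (intro tendsto_net_eval[where k = k]) (auto simp: g_def grid_rat_tendsto)
    then have lim: "(\<lambda>m. vec_index (net_eval (map_params (g m) ?\<Theta>1) (\<phi> i)) 0) \<longlonglongrightarrow> h i + e"
      using net_eval_affine_last[OF wf assms(3)[OF i], of 1 e] by (simp add: h_def)
    show ?thesis
    proof (cases "0 \<le> h i")
      case True
      then have "0 < h i + e" using e by simp
      then have "\<forall>\<^sub>F m in sequentially. 0 < vec_index (net_eval (map_params (g m) ?\<Theta>1) (\<phi> i)) 0"
        using lim order_tendstoD(1) by blast
      then show ?thesis by eventually_elim (use True in simp)
    next
      case False
      then have "h i + e < 0" using e i by simp
      then have "\<forall>\<^sub>F m in sequentially. vec_index (net_eval (map_params (g m) ?\<Theta>1) (\<phi> i)) 0 < 0"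
        using lim order_tendstoD(2) by blast
      then show ?thesis by eventually_elim (use False in simp)
    qed
  qed
  have "\<forall>\<^sub>F m in sequentially. \<forall>i\<in>I. 0 \<le> vec_index (net_eval (map_params (g m) ?\<Theta>1) (\<phi> i)) 0 \<longleftrightarrow> 0 \<le> h i"
    by (rule eventually_ball_finite[OF assms(2)]) (use ev in blast)
  then obtain m where m: "\<forall>i\<in>I. 0 \<le> vec_index (net_eval (map_params (g m) ?\<Theta>1) (\<phi> i)) 0 \<longleftrightarrow> 0 \<le> h i"
    using eventually_happens'[OF sequentially_bot] by blast
  have "map_params (g m) ?\<Theta>1 \<in> rational_nets k r N"
    unfolding rational_nets_def
    using map_params_relu_nets[OF affine_last_relu_nets[OF assms(1)]] grid_params_in_range[of m ?\<Theta>1]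
    by (simp add: g_def[abs_def])
  then show ?thesis using m by (auto simp: h_def)
qed

section \<open>Symmetrization with an offset\<close>

text \<open>The bound \<open>cosh s \<le> exp (s\<^sup>2 / 2)\<close>, read off from the estimate
  behind Hoeffding's lemma for a fair two-point variable of range \<open>2 * s\<close>.\<close>

lemma exp_add_exp_minus_le: "exp s + exp (- s) \<le> 2 * exp (s\<^sup>2 / 2)" for s :: real
proof -
  have pos: "exp s + exp (- s) \<le> 2 * exp (s\<^sup>2 / 2)" if "0 \<le> s" for s :: real
  proof -
    have "- s + ln ((exp (2 * s) + 1) / 2) \<le> s\<^sup>2 / 2"
      using Hoeffdings_lemma_aux[of "2 * s" "1 / 2"] that by (simp add: field_simps)
    then have "ln ((exp (2 * s) + 1) / 2) \<le> s + s\<^sup>2 / 2" by simp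
    then have "exp (ln ((exp (2 * s) + 1) / 2)) \<le> exp (s + s\<^sup>2 / 2)" by (subst exp_le_cancel_iff)
    then have "exp (2 * s) + 1 \<le> 2 * (exp s * exp (s\<^sup>2 / 2))"
      by (subst (asm) exp_ln) (simp_all add: exp_add add_pos_pos)
    then have "exp (- s) * (exp (2 * s) + 1) \<le> exp (- s) * (2 * (exp s * exp (s\<^sup>2 / 2)))"
      by (intro mult_left_mono) simp_all
    moreover have "exp (- s) * (exp (2 * s) + 1) = exp s + exp (- s)"
      by (simp add: distrib_left flip: exp_add)
    moreover have "exp (- s) * (2 * (exp s * exp (s\<^sup>2 / 2))) = 2 * exp (s\<^sup>2 / 2)"
      by (simp add: exp_minus)
    ultimately show ?thesis by simp
  qed
  show ?thesis
    using pos[of s] pos[of "- s"] by (cases "0 \<le> s") simp_all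
qed

text \<open>
  The second moment is penalised with weight \<open>3\<close> on the ghost sample and \<open>-1\<close> on the sample, so
  that the penalty keeps a negative mean when the two are swapped. The offset then absorbs the
  variance of the difference.
\<close>

definition swap_weight :: "real \<Rightarrow> real \<Rightarrow> real \<Rightarrow> real" where
  "swap_weight \<eta> a b = exp (\<eta> / 2 * ((b - a) - \<eta> * (3 * b\<^sup>2 - a\<^sup>2)))"

text \<open>The exponent splits into a part \<open>- r\<close> that is symmetric in \<open>a\<close>
  and \<open>b\<close> and a part \<open>s\<close> that changes sign under the swap, because
  \<open>3 * b\<^sup>2 - a\<^sup>2 = (a\<^sup>2 + b\<^sup>2) + 2 * (b\<^sup>2 - a\<^sup>2)\<close>.
  The sum is then a \<open>cosh\<close>, and its Gaussian bound is compensated by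
  \<open>r\<close>.\<close>

lemma swap_weight_add_le:
  assumes "a \<in> {-1, 0, 1}" and "b \<in> {-1, 0, 1}" and "0 < \<eta>" and "\<eta> \<le> 1 / 2"
  shows "swap_weight \<eta> a b + swap_weight \<eta> b a \<le> 2"
proof -
  define s where "s = \<eta> / 2 * ((b - a) - 2 * \<eta> * (b\<^sup>2 - a\<^sup>2))"
  define r where "r = \<eta> / 2 * \<eta> * (a\<^sup>2 + b\<^sup>2)"
  have "swap_weight \<eta> a b = exp (- r) * exp s" "swap_weight \<eta> b a = exp (- r) * exp (- s)"
    by (simp_all add: swap_weight_def s_def r_def field_simps flip: exp_add)
  then have "swap_weight \<eta> a b + swap_weight \<eta> b a = exp (- r) * (exp s + exp (- s))"
    by (simp add: distrib_left)
  also have "\<dots> \<le> exp (- r) * (2 * exp (s\<^sup>2 / 2))"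
    by (intro mult_left_mono exp_add_exp_minus_le) simp
  also have "\<dots> = 2 * exp (s\<^sup>2 / 2 - r)" by (simp add: mult_ac flip: exp_add)
  also have "\<dots> \<le> 2"
  proof -
    \<comment> \<open>Since \<open>s\<close> contains the factor
      \<open>(b - a) * (1 - 2 * \<eta> * (a + b))\<close>, the critical case is
      \<open>\<bar>b - a\<bar> = 1\<close> with \<open>a + b = 1\<close> or
      \<open>a + b = -1\<close>; it needs \<open>1 + 2 * \<eta> \<le> 2\<close>.\<close>
    have 1: "(1 + 2 * \<eta>)\<^sup>2 \<le> 4" "(1 - 2 * \<eta>)\<^sup>2 \<le> 4"
      using assms(3,4) abs_le_square_iff[of "1 + 2 * \<eta>" 2] abs_le_square_iff[of "1 - 2 * \<eta>" 2] by auto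
    have "((b - a) - 2 * \<eta> * (b\<^sup>2 - a\<^sup>2))\<^sup>2 \<le> 4 * (a\<^sup>2 + b\<^sup>2)"
      using assms(1,2) 1 by (auto simp: power2_eq_square algebra_simps)
    then have "(\<eta> / 2)\<^sup>2 * ((b - a) - 2 * \<eta> * (b\<^sup>2 - a\<^sup>2))\<^sup>2 \<le> (\<eta> / 2)\<^sup>2 * (4 * (a\<^sup>2 + b\<^sup>2))"
      by (intro mult_left_mono) simp_all
    then have "s\<^sup>2 \<le> (\<eta> / 2)\<^sup>2 * (4 * (a\<^sup>2 + b\<^sup>2))"
      unfolding s_def by (simp only: power_mult_distrib)
    also have "\<dots> = 2 * r" by (simp add: r_def power2_eq_square)
    finally show ?thesis by simp
  qed
  finally show ?thesis .
qed

text \<open>The involution exchanging \<open>i\<close> and \<open>n + i\<close> for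
  \<open>i \<in> A\<close>, where the first half of the indices is the sample and the second half
  the ghost sample. Averaging over all \<open>A\<close> takes the place of random signs, without
  enlarging the probability space.\<close>

definition swap_index :: "nat \<Rightarrow> nat set \<Rightarrow> nat \<Rightarrow> nat" where
  "swap_index n A i =
     (if i < n then if i \<in> A then n + i else i else if i - n \<in> A then i - n else i)"

lemma swap_index_swap_index: "A \<subseteq> {..<n} \<Longrightarrow> swap_index n A (swap_index n A i) = i"
  by (auto simp: swap_index_def)

lemma swap_index_less: "A \<subseteq> {..<n} \<Longrightarrow> i < 2 * n \<Longrightarrow> swap_index n A i < 2 * n"
  by (auto simp: swap_index_def)

lemma distr_swap_index:
  assumes "prob_space P" and "A \<subseteq> {..<n}"
  shows "distr (PiM {..<2 * n} (\<lambda>_. P)) (PiM {..<2 * n} (\<lambda>_. P))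
    (\<lambda>w. \<lambda>i\<in>{..<2 * n}. w (swap_index n A i)) = PiM {..<2 * n} (\<lambda>_. P)"
proof (rule distr_PiM_reindex)
  show "inj_on (swap_index n A) {..<2 * n}"
    by (rule inj_on_inverseI[of _ "swap_index n A"]) (rule swap_index_swap_index[OF assms(2)])
  show "swap_index n A \<in> {..<2 * n} \<rightarrow> {..<2 * n}"
    using swap_index_less[OF assms(2)] by auto
qed (rule assms(1))

text \<open>Expansion of a product of two-term sums: \<open>A\<close> is the set of factors in which
  the swapped term is chosen.\<close>

lemma sum_Pow_prod_swap:
  fixes h :: "real \<Rightarrow> real \<Rightarrow> real"
  shows "(\<Sum>A\<in>Pow {..<n}. \<Prod>i<n. h (v (swap_index n A i)) (v (swap_index n A (n + i)))) =
    (\<Prod>i<n. h (v (n + i)) (v i) + h (v i) (v (n + i)))"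
proof -
  have "(\<Prod>i<n. h (v (swap_index n A i)) (v (swap_index n A (n + i)))) =
      (\<Prod>i\<in>A. h (v (n + i)) (v i)) * (\<Prod>i\<in>{..<n} - A. h (v i) (v (n + i)))"
    if A: "A \<in> Pow {..<n}" for A
  proof -
    let ?f = "\<lambda>i. h (v (swap_index n A i)) (v (swap_index n A (n + i)))"
    have "(\<Prod>i<n. ?f i) = (\<Prod>i\<in>{..<n} - A. ?f i) * (\<Prod>i\<in>A. ?f i)"
      using A by (intro prod.subset_diff) auto
    also have "(\<Prod>i\<in>A. ?f i) = (\<Prod>i\<in>A. h (v (n + i)) (v i))"
      using A by (intro prod.cong) (auto simp: swap_index_def)
    also have "(\<Prod>i\<in>{..<n} - A. ?f i) = (\<Prod>i\<in>{..<n} - A. h (v i) (v (n + i)))"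
      by (intro prod.cong) (auto simp: swap_index_def)
    finally show ?thesis by (simp add: mult.commute)
  qed
  then show ?thesis by (simp add: prod_add)
qed

lemma measurable_prod_swap_weight:
  fixes n :: nat
  assumes g: "g \<in> borel_measurable P"
  shows "(\<lambda>w. ennreal (\<Prod>i<n. swap_weight \<eta> (g (w i)) (g (w (n + i))))) \<in>
    borel_measurable (PiM {..<2 * n} (\<lambda>_. P))"
proof -
  have c: "(\<lambda>w. g (w i)) \<in> borel_measurable (PiM {..<2 * n} (\<lambda>_. P))" if "i < 2 * n" for i
    by (rule measurable_compose[OF measurable_component_singleton[where M = "\<lambda>_. P"] g]) (use that in simp)
  have "(\<lambda>w. swap_weight \<eta> (g (w i)) (g (w (n + i)))) \<in> borel_measurable (PiM {..<2 * n} (\<lambda>_. P))"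
    if "i < n" for i
  proof -
    have [measurable]: "(\<lambda>w. g (w i)) \<in> borel_measurable (PiM {..<2 * n} (\<lambda>_. P))"
      using that by (intro c) simp
    have [measurable]: "(\<lambda>w. g (w (n + i))) \<in> borel_measurable (PiM {..<2 * n} (\<lambda>_. P))"
      using that by (intro c) simp
    show ?thesis unfolding swap_weight_def by measurable
  qed
  then show ?thesis by (intro measurable_compose[OF _ measurable_ennreal] borel_measurable_prod) auto
qed

text \<open>The product law is invariant under each of the \<open>2 ^ n\<close> swaps, so the
  integrand may be averaged over them. For a fixed double sample the supremum is at most a sum over
  \<open>M\<close> value vectors, and for each vector the average factorises into factors of at most
  1.\<close>

lemma nn_integral_SUP_swap_weight_le:
  fixes P :: "'z measure" and G :: "('z \<Rightarrow> real) set" and n :: nat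
  assumes P: "prob_space P" and G: "countable G"
    and meas: "\<And>g. g \<in> G \<Longrightarrow> g \<in> borel_measurable P"
    and vals: "\<And>g z. g \<in> G \<Longrightarrow> z \<in> space P \<Longrightarrow> g z \<in> {-1, 0, 1}"
    and card: "\<And>w. w \<in> {..<2 * n} \<rightarrow>\<^sub>E space P \<Longrightarrow> card ((\<lambda>g. \<lambda>i\<in>{..<2 * n}. g (w i)) ` G) \<le> M"
    and \<eta>: "0 < \<eta>" "\<eta> \<le> 1 / 2"
  shows "(\<integral>\<^sup>+w. (SUP g\<in>G. ennreal (\<Prod>i<n. swap_weight \<eta> (g (w i)) (g (w (n + i)))))
    \<partial>PiM {..<2 * n} (\<lambda>_. P)) \<le> ennreal (real M)"
proof -
  let ?J = "{..<2 * n}"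
  let ?Q = "PiM ?J (\<lambda>_. P)"
  interpret Q: prob_space ?Q by (rule prob_space_PiM) (rule P)
  define H where "H w = (SUP g\<in>G. ennreal (\<Prod>i<n. swap_weight \<eta> (g (w i)) (g (w (n + i)))))" for w
  define T where "T A w = (\<lambda>i\<in>?J. w (swap_index n A i))" for A and w :: "nat \<Rightarrow> 'z"
  have H [measurable]: "H \<in> borel_measurable ?Q"
    unfolding H_def[abs_def] using G by (rule borel_measurable_SUP) (intro measurable_prod_swap_weight meas)
  have T [measurable]: "T A \<in> ?Q \<rightarrow>\<^sub>M ?Q" if "A \<in> Pow {..<n}" for A
    unfolding T_def using swap_index_less[of A n] that
    by (intro measurable_restrict measurable_component_singleton) auto
  have pt: "(\<Sum>A\<in>Pow {..<n}. H (T A w)) \<le> ennreal (2 ^ n * real M)" if w: "w \<in> space ?Q" for w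
  proof -
    have wP: "w i \<in> space P" if "i < 2 * n" for i using w that by (auto simp: space_PiM)
    define V where "V = (\<lambda>g. \<lambda>i\<in>?J. g (w i)) ` G"
    define \<Phi> where "\<Phi> A v = (\<Prod>i<n. swap_weight \<eta> (v (swap_index n A i)) (v (swap_index n A (n + i))))" for A and v :: "nat \<Rightarrow> real"
    have \<Phi>0: "0 \<le> \<Phi> A v" for A v by (simp add: \<Phi>_def prod_nonneg swap_weight_def)
    have V: "v i \<in> {-1, 0, 1}" if "v \<in> V" "i < 2 * n" for v i
    proof -
      obtain g where "g \<in> G" "v = (\<lambda>i\<in>?J. g (w i))" using \<open>v \<in> V\<close> by (auto simp: V_def)
      then show ?thesis using vals[of g "w i"] wP[of i] \<open>i < 2 * n\<close> by simp
    qed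
    have "V \<subseteq> ?J \<rightarrow>\<^sub>E {-1, 0, 1}"
    proof
      fix v assume v: "v \<in> V"
      then have "v \<in> extensional ?J" unfolding V_def by (elim imageE) (simp only: restrict_extensional)
      then show "v \<in> ?J \<rightarrow>\<^sub>E {-1, 0, 1}" using V[OF v] by (intro PiE_I) (auto simp: extensional_def)
    qed
    moreover have "finite (?J \<rightarrow>\<^sub>E {-1, 0, 1 :: real})" by (rule finite_PiE) simp_all
    ultimately have finV: "finite V" by (rule finite_subset)
    \<comment> \<open>Union bound: all swaps of \<open>w\<close> are evaluated through the same
      finite set \<open>V\<close>, which is read off from the unswapped points.\<close>
    have le: "H (T A w) \<le> ennreal (\<Sum>v\<in>V. \<Phi> A v)" if A: "A \<in> Pow {..<n}" for A
      unfolding H_def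
    proof (rule SUP_least)
      fix g assume g: "g \<in> G"
      let ?v = "\<lambda>i\<in>?J. g (w i)"
      have "(\<Prod>i<n. swap_weight \<eta> (g (T A w i)) (g (T A w (n + i)))) = \<Phi> A ?v"
        unfolding \<Phi>_def T_def using swap_index_less[of A n] A
        by (intro prod.cong refl) simp
      also have "\<dots> \<le> (\<Sum>v\<in>V. \<Phi> A v)"
      proof (rule member_le_sum)
        show "?v \<in> V" unfolding V_def by (rule image_eqI[OF refl g])
      qed (use finV \<Phi>0 in auto)
      finally show "ennreal (\<Prod>i<n. swap_weight \<eta> (g (T A w i)) (g (T A w (n + i)))) \<le> ennreal (\<Sum>v\<in>V. \<Phi> A v)"
        by (rule ennreal_leI)
    qed
    have "(\<Sum>A\<in>Pow {..<n}. H (T A w)) \<le> (\<Sum>A\<in>Pow {..<n}. ennreal (\<Sum>v\<in>V. \<Phi> A v))"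
      by (rule sum_mono) (rule le)
    also have "\<dots> = ennreal (\<Sum>A\<in>Pow {..<n}. \<Sum>v\<in>V. \<Phi> A v)"
      using \<Phi>0 by (intro sum_ennreal sum_nonneg)
    also have "\<dots> = ennreal (\<Sum>v\<in>V. \<Sum>A\<in>Pow {..<n}. \<Phi> A v)"
      by (subst sum.swap) (rule refl)
    also have "\<dots> \<le> ennreal (\<Sum>v\<in>V. 2 ^ n)"
    proof (intro ennreal_leI sum_mono)
      fix v assume v: "v \<in> V"
      have "(\<Sum>A\<in>Pow {..<n}. \<Phi> A v) = (\<Prod>i<n. swap_weight \<eta> (v (n + i)) (v i) + swap_weight \<eta> (v i) (v (n + i)))"
        unfolding \<Phi>_def by (rule sum_Pow_prod_swap)
      also have "\<dots> \<le> (\<Prod>i<n. 2)"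
        using V[OF v] \<eta> by (intro prod_mono conjI swap_weight_add_le add_nonneg_nonneg) (auto simp: swap_weight_def)
      finally show "(\<Sum>A\<in>Pow {..<n}. \<Phi> A v) \<le> 2 ^ n" by simp
    qed
    also have "\<dots> \<le> ennreal (2 ^ n * real M)"
      using card[of w] w by (intro ennreal_leI) (simp add: V_def space_PiM)
    finally show ?thesis .
  qed
  have inv: "(\<integral>\<^sup>+w. H (T A w) \<partial>?Q) = (\<integral>\<^sup>+w. H w \<partial>?Q)" if A: "A \<in> Pow {..<n}" for A
  proof -
    have "(\<integral>\<^sup>+w. H w \<partial>?Q) = (\<integral>\<^sup>+w. H w \<partial>distr ?Q ?Q (T A))"
      using distr_swap_index[OF P, of A n] A by (simp add: T_def[abs_def])
    also have "\<dots> = (\<integral>\<^sup>+w. H (T A w) \<partial>?Q)"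
      by (rule nn_integral_distr[OF T[OF A]]) (simp add: H)
    finally show ?thesis by simp
  qed
  have "ennreal (2 ^ n) * (\<integral>\<^sup>+w. H w \<partial>?Q) = (\<Sum>A\<in>Pow {..<n}. \<integral>\<^sup>+w. H (T A w) \<partial>?Q)"
    using inv by (simp add: card_Pow flip: ennreal_power)
  also have "\<dots> = (\<integral>\<^sup>+w. (\<Sum>A\<in>Pow {..<n}. H (T A w)) \<partial>?Q)"
    using measurable_compose[OF T H] by (intro nn_integral_sum[symmetric])
  also have "\<dots> \<le> (\<integral>\<^sup>+w. ennreal (2 ^ n * real M) \<partial>?Q)"
    by (rule nn_integral_mono) (rule pt)
  also have "\<dots> = ennreal (2 ^ n) * ennreal (real M)"
    by (simp add: Q.emeasure_space_1 ennreal_mult)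
  finally have "ennreal (2 ^ n) * (\<integral>\<^sup>+w. H w \<partial>?Q) \<le> ennreal (2 ^ n) * ennreal (real M)" .
  then have "(\<integral>\<^sup>+w. H w \<partial>?Q) \<le> ennreal (real M)"
    by (subst (asm) ennreal_mult_le_mult_iff) simp_all
  then show ?thesis by (simp only: H_def)
qed

text \<open>Jensen's inequality from the tangent line of \<open>exp\<close> at the mean.\<close>

lemma (in prob_space) exp_expectation_le:
  fixes X :: "'a \<Rightarrow> real"
  assumes "integrable M X" and "integrable M (\<lambda>x. exp (X x))"
  shows "exp (expectation X) \<le> expectation (\<lambda>x. exp (X x))"
proof -
  define m where "m = expectation X"
  have "exp m = expectation (\<lambda>x. exp m * (1 + (X x - m)))"
    using assms(1) by (simp add: prob_space m_def)
  also have "\<dots> \<le> expectation (\<lambda>x. exp (X x))"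
  proof (rule integral_mono)
    fix x
    have "exp m * (1 + (X x - m)) \<le> exp m * exp (X x - m)"
      by (intro mult_left_mono exp_ge_add_one_self) simp
    then show "exp m * (1 + (X x - m)) \<le> exp (X x)" by (simp flip: exp_add)
  qed (use assms in simp_all)
  finally show ?thesis by (simp add: m_def)
qed

text \<open>
  The selected functions need not depend measurably on the sample: only the countable family \<open>G\<close>
  and the lower bound \<open>\<phi>\<close> enter the integrals.
\<close>

lemma nn_integral_exp_selected_le:
  fixes P :: "'z measure" and G :: "('z \<Rightarrow> real) set" and \<phi> :: "(nat \<Rightarrow> 'z) \<Rightarrow> real"
  assumes P: "prob_space P" and G: "countable G"
    and meas: "\<And>g. g \<in> G \<Longrightarrow> g \<in> borel_measurable P"
    and vals: "\<And>g z. g \<in> G \<Longrightarrow> z \<in> space P \<Longrightarrow> g z \<in> {-1, 0, 1}"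
    and card: "\<And>w. w \<in> {..<2 * n} \<rightarrow>\<^sub>E space P \<Longrightarrow> card ((\<lambda>g. \<lambda>i\<in>{..<2 * n}. g (w i)) ` G) \<le> M"
    and \<eta>: "0 < \<eta>" "\<eta> \<le> 1 / 2"
    and sel: "\<And>D. D \<in> {..<n} \<rightarrow>\<^sub>E space P \<Longrightarrow>
      \<exists>h. h \<in> borel_measurable P \<and> (\<forall>z\<in>space P. h z \<in> {-1, 0, 1}) \<and>
        (\<Sum>i<n. h (D i)) \<le> 0 \<and>
        (\<forall>w\<in>{..<2 * n} \<rightarrow>\<^sub>E space P. \<exists>g\<in>G. \<forall>i<2 * n. g (w i) = h (w i)) \<and>
        \<phi> D \<le> (\<integral>z. h z \<partial>P) - 3 * \<eta> * (\<integral>z. (h z)\<^sup>2 \<partial>P)"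
  shows "(\<integral>\<^sup>+D. ennreal (exp (\<eta> / 2 * real n * \<phi> D)) \<partial>PiM {..<n} (\<lambda>_. P)) \<le> ennreal (real M)"
proof -
  interpret P: prob_space P by (rule P)
  interpret product_sigma_finite "\<lambda>_::nat. P" by standard
  let ?I = "{..<n}" and ?J = "{n..<2 * n}"
  define H where "H w = (SUP g\<in>G. ennreal (\<Prod>i<n. swap_weight \<eta> (g (w i)) (g (w (n + i)))))" for w
  have H: "H \<in> borel_measurable (PiM {..<2 * n} (\<lambda>_. P))"
    unfolding H_def[abs_def] using G by (rule borel_measurable_SUP) (intro measurable_prod_swap_weight meas)
  have un: "?I \<union> ?J = {..<2 * n}" by auto
  have le: "ennreal (exp (\<eta> / 2 * real n * \<phi> D)) \<le> (\<integral>\<^sup>+D'. H (merge ?I ?J (D, D')) \<partial>PiM ?J (\<lambda>_. P))"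
    if D: "D \<in> space (PiM ?I (\<lambda>_. P))" for D
  proof -
    have D': "D \<in> ?I \<rightarrow>\<^sub>E space P" using D by (simp add: space_PiM)
    from sel[OF D'] obtain h where h [measurable]: "h \<in> borel_measurable P"
      and hv: "\<And>z. z \<in> space P \<Longrightarrow> h z \<in> {-1, 0, 1}" and erm: "(\<Sum>i<n. h (D i)) \<le> 0"
      and match: "\<And>w. w \<in> {..<2 * n} \<rightarrow>\<^sub>E space P \<Longrightarrow> \<exists>g\<in>G. \<forall>i<2 * n. g (w i) = h (w i)"
      and \<phi>: "\<phi> D \<le> (\<integral>z. h z \<partial>P) - 3 * \<eta> * (\<integral>z. (h z)\<^sup>2 \<partial>P)"
      by blast
    \<comment> \<open>The share of a ghost point in the exponent of \<open>swap_weight\<close>. Its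
      mean is \<open>\<eta> / 2\<close> times the right-hand side of the bound on
      \<open>\<phi> D\<close>.\<close>
    define X where "X z = \<eta> / 2 * (h z - 3 * \<eta> * (h z)\<^sup>2)" for z
    have X [measurable]: "X \<in> borel_measurable P" unfolding X_def by measurable
    have hb: "\<bar>h z\<bar> \<le> 1" "(h z)\<^sup>2 \<le> 1" if "z \<in> space P" for z using hv[OF that] by auto
    have ih: "integrable P h" "integrable P (\<lambda>z. (h z)\<^sup>2)"
      by (rule P.integrable_const_bound[where B = 1]; (auto intro!: AE_I2 simp: hb))+
    then have iX: "integrable P X" unfolding X_def by simp
    have Xb: "X z \<le> \<eta> / 2" if "z \<in> space P" for z
    proof -
      have "h z - 3 * \<eta> * (h z)\<^sup>2 \<le> 1" using hv[OF that] \<eta> by auto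
      then have "\<eta> / 2 * (h z - 3 * \<eta> * (h z)\<^sup>2) \<le> \<eta> / 2 * 1" using \<eta> by (intro mult_left_mono) auto
      then show ?thesis by (simp add: X_def)
    qed
    have ieX: "integrable P (\<lambda>z. exp (X z))"
      using Xb by (intro P.integrable_const_bound[where B = "exp (\<eta> / 2)"]) (auto intro!: AE_I2)
    have "\<eta> / 2 * real n * \<phi> D \<le> \<eta> / 2 * real n * ((\<integral>z. h z \<partial>P) - 3 * \<eta> * (\<integral>z. (h z)\<^sup>2 \<partial>P))"
      using \<phi> \<eta> by (intro mult_left_mono) auto
    also have "\<dots> = real n * (\<integral>z. X z \<partial>P)"
      unfolding X_def using ih by simp
    finally have "exp (\<eta> / 2 * real n * \<phi> D) \<le> exp (real n * (\<integral>z. X z \<partial>P))"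
      by (subst exp_le_cancel_iff)
    also have "\<dots> = exp (\<integral>z. X z \<partial>P) ^ n" by (rule exp_of_nat_mult)
    \<comment> \<open>Jensen's inequality moves the exponential inside; the power is then an
      integral over \<open>n\<close> independent ghost points, with the sample \<open>D\<close> held
      fixed.\<close>
    also have "\<dots> \<le> (\<integral>z. exp (X z) \<partial>P) ^ n"
      by (intro power_mono P.exp_expectation_le iX ieX) simp
    finally have "ennreal (exp (\<eta> / 2 * real n * \<phi> D)) \<le> ennreal (\<integral>z. exp (X z) \<partial>P) ^ n"
      by (simp add: ennreal_power ennreal_leI)
    also have "ennreal (\<integral>z. exp (X z) \<partial>P) = (\<integral>\<^sup>+z. ennreal (exp (X z)) \<partial>P)"
      by (rule nn_integral_eq_integral[symmetric, OF ieX]) simp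
    also have "(\<integral>\<^sup>+z. ennreal (exp (X z)) \<partial>P) ^ n = (\<Prod>i\<in>?J. \<integral>\<^sup>+z. ennreal (exp (X z)) \<partial>P)"
      by simp
    also have "\<dots> = (\<integral>\<^sup>+D'. (\<Prod>i\<in>?J. ennreal (exp (X (D' i)))) \<partial>PiM ?J (\<lambda>_. P))"
      by (rule product_nn_integral_prod[symmetric]) auto
    also have "\<dots> \<le> (\<integral>\<^sup>+D'. H (merge ?I ?J (D, D')) \<partial>PiM ?J (\<lambda>_. P))"
    proof (rule nn_integral_mono)
      fix E assume E: "E \<in> space (PiM ?J (\<lambda>_. P))"
      let ?w = "merge ?I ?J (D, E)"
      have w: "?w \<in> {..<2 * n} \<rightarrow>\<^sub>E space P"
        using D E by (auto simp: space_PiM merge_def PiE_iff extensional_def)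
      have w1: "?w i = D i" "?w (n + i) = E (n + i)" if "i < n" for i
        using that by (auto simp: merge_def)
      \<comment> \<open>\<open>h\<close> need not belong to \<open>G\<close>, and \<open>g\<close>
        may change with the ghost sample; agreement on the present \<open>2 * n\<close> points is
        enough below the supremum.\<close>
      from match[OF w] obtain g where g: "g \<in> G" "\<forall>i<2 * n. g (?w i) = h (?w i)" by blast
      \<comment> \<open>The sample's share of the exponent is nonnegative: empirical minimality
        makes the sum of \<open>- h (D i)\<close> nonnegative, and the penalty has the favourable
        sign on the sample.\<close>
      have "(\<Sum>i<n. X (E (n + i))) \<le>
          (\<Sum>i<n. X (E (n + i)) + \<eta> / 2 * (- h (D i) + \<eta> * (h (D i))\<^sup>2))"
      proof -
        have "(\<Sum>i<n. \<eta> / 2 * (- h (D i) + \<eta> * (h (D i))\<^sup>2)) =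
            \<eta> / 2 * (- (\<Sum>i<n. h (D i)) + \<eta> * (\<Sum>i<n. (h (D i))\<^sup>2))"
          by (simp only: sum_distrib_left[symmetric] sum.distrib sum_negf)
        also have "\<dots> \<ge> 0"
          using erm \<eta> by (intro mult_nonneg_nonneg add_nonneg_nonneg sum_nonneg) auto
        finally show ?thesis by (simp add: sum.distrib)
      qed
      then have "exp (\<Sum>i<n. X (E (n + i))) \<le>
          exp (\<Sum>i<n. X (E (n + i)) + \<eta> / 2 * (- h (D i) + \<eta> * (h (D i))\<^sup>2))" by simp
      also have "\<dots> = (\<Prod>i<n. swap_weight \<eta> (g (?w i)) (g (?w (n + i))))"
        unfolding exp_sum[OF finite_lessThan]
      proof (intro prod.cong refl)
        fix i assume "i \<in> {..<n}"
        then have i: "i < n" by simp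
        have "g (?w i) = h (D i)" "g (?w (n + i)) = h (E (n + i))"
          using g(2)[rule_format, of i] g(2)[rule_format, of "n + i"] i w1[OF i] by auto
        then show "exp (X (E (n + i)) + \<eta> / 2 * (- h (D i) + \<eta> * (h (D i))\<^sup>2)) =
            swap_weight \<eta> (g (?w i)) (g (?w (n + i)))"
          by (simp add: swap_weight_def X_def algebra_simps)
      qed
      finally have "ennreal (exp (\<Sum>i<n. X (E (n + i)))) \<le>
          ennreal (\<Prod>i<n. swap_weight \<eta> (g (?w i)) (g (?w (n + i))))" by (rule ennreal_leI)
      also have "\<dots> \<le> H ?w"
        unfolding H_def using g(1) by (rule SUP_upper)
      also have "exp (\<Sum>i<n. X (E (n + i))) = (\<Prod>i\<in>?J. exp (X (E i)))"
      proof -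
        have "(\<Prod>i\<in>?J. exp (X (E i))) = (\<Prod>i<n. exp (X (E (n + i))))"
          by (rule prod.reindex_bij_witness[of _ "\<lambda>i. n + i" "\<lambda>i. i - n"]) auto
        then show ?thesis by (simp add: exp_sum)
      qed
      finally show "(\<Prod>i\<in>?J. ennreal (exp (X (E i)))) \<le> H ?w"
        by (simp add: prod_ennreal)
    qed
    finally show ?thesis .
  qed
  have "(\<integral>\<^sup>+D. ennreal (exp (\<eta> / 2 * real n * \<phi> D)) \<partial>PiM ?I (\<lambda>_. P)) \<le>
      (\<integral>\<^sup>+D. \<integral>\<^sup>+D'. H (merge ?I ?J (D, D')) \<partial>PiM ?J (\<lambda>_. P) \<partial>PiM ?I (\<lambda>_. P))"
    by (rule nn_integral_mono) (rule le)
  also have "\<dots> = (\<integral>\<^sup>+w. H w \<partial>PiM (?I \<union> ?J) (\<lambda>_. P))"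
    using H by (intro product_nn_integral_fold[symmetric]) (auto simp: un)
  also have "\<dots> \<le> ennreal (real M)"
    unfolding un H_def using P G meas vals card \<eta> by (rule nn_integral_SUP_swap_weight_le)
  finally show ?thesis .
qed

text \<open>Jensen's inequality once more; integrability of the exponential is part of what the
  bound on the nonnegative integral provides.\<close>

lemma (in prob_space) expectation_le_of_nn_integral_exp:
  fixes X :: "'a \<Rightarrow> real"
  assumes X: "integrable M X" and "0 < c" and m: "0 < m"
    and le: "(\<integral>\<^sup>+x. ennreal (exp (c * X x)) \<partial>M) \<le> ennreal m"
  shows "expectation X \<le> ln m / c"
proof -
  have i: "integrable M (\<lambda>x. exp (c * X x))"
  proof (rule integrableI_bounded)
    have "(\<integral>\<^sup>+x. ennreal (norm (exp (c * X x))) \<partial>M) \<le> ennreal m" using le by simp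
    also have "\<dots> < \<infinity>" by simp
    finally show "(\<integral>\<^sup>+x. ennreal (norm (exp (c * X x))) \<partial>M) < \<infinity>" .
  qed (use X in simp)
  have "ennreal (exp (expectation (\<lambda>x. c * X x))) \<le> ennreal (expectation (\<lambda>x. exp (c * X x)))"
    using X i by (intro ennreal_leI exp_expectation_le) simp_all
  also have "\<dots> = (\<integral>\<^sup>+x. ennreal (exp (c * X x)) \<partial>M)"
    by (rule nn_integral_eq_integral[symmetric, OF i]) simp
  also have "\<dots> \<le> ennreal m" by (rule le)
  finally have "exp (c * expectation X) \<le> m" using m by (simp add: ennreal_le_iff)
  then have "c * expectation X \<le> ln m" using m by (simp add: ln_ge_iff)
  then show ?thesis using \<open>0 < c\<close> by (simp add: field_simps)
qed

section \<open>Excess risk and second moments\<close>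

lemma space_class_law: "space (class_law X p q) = X \<times> {-1, 1}"
  by (simp add: class_law_def space_pair_measure space_restrict_space)

lemma sets_class_law:
  "sets (class_law X p q) = sets (restrict_space lborel X \<Otimes>\<^sub>M count_space {-1, 1})"
  by (simp add: class_law_def)

lemma finite_measure_restrict_compact:
  fixes X :: "(real ^ 'd) set"
  assumes "compact X"
  shows "finite_measure (restrict_space lborel X)"
proof
  have "X \<in> sets lborel" using assms by (simp add: compact_imp_closed borel_closed)
  then have "emeasure (restrict_space lborel X) (space (restrict_space lborel X)) = emeasure lborel X"
    by (simp add: space_restrict_space emeasure_restrict_space)
  then show "emeasure (restrict_space lborel X) (space (restrict_space lborel X)) \<noteq> \<infinity>"
    using emeasure_compact_finite[OF assms] by simp
qed

lemma prob_space_class_law: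
  fixes p q :: "real ^ 'd \<Rightarrow> real"
  assumes X: "X \<in> sets lborel" and p: "bounded_density X K p" and q: "bounded_density X K q"
  shows "prob_space (class_law X p q)"
proof
  let ?R = "restrict_space lborel X"
  have XR: "X \<in> sets ?R" using X by (auto simp: sets_restrict_space)
  have half: "emeasure (class_law X p q) (X \<times> {y}) = ennreal (1 / 2)" if "y \<in> {-1, 1}" for y
  proof -
    have "emeasure (class_law X p q) (X \<times> {y}) =
        ennreal (1 / 2) * (\<integral>\<^sup>+x. ennreal ((if y = 1 then p else q) x) * indicator X x \<partial>?R)"
      by (rule emeasure_class_law[OF p q XR that])
    also have "(\<integral>\<^sup>+x. ennreal ((if y = 1 then p else q) x) * indicator X x \<partial>?R) =
        (\<integral>\<^sup>+x. ennreal ((if y = 1 then p else q) x) \<partial>?R)"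
      by (rule nn_integral_cong) (simp add: space_restrict_space)
    also have "\<dots> = 1" using p q by (auto simp: bounded_density_def)
    finally show ?thesis by simp
  qed
  have m: "X \<times> {y} \<in> sets (class_law X p q)" if "y \<in> {-1, 1}" for y :: int
    unfolding sets_class_law using XR that by (intro pair_measureI) auto
  have "space (class_law X p q) = X \<times> {-1} \<union> X \<times> {1}"
    by (auto simp: space_class_law)
  also have "emeasure (class_law X p q) \<dots> =
      emeasure (class_law X p q) (X \<times> {-1}) + emeasure (class_law X p q) (X \<times> {1})"
    by (rule plus_emeasure[symmetric]) (auto intro: m)
  also have "\<dots> = ennreal (1 / 2) + ennreal (1 / 2)"
    using half[of "-1"] half[of 1] by simp
  also have "\<dots> = ennreal (1 / 2 + 1 / 2)"
    by (rule ennreal_plus[symmetric]) simp_all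
  finally show "emeasure (class_law X p q) (space (class_law X p q)) = 1" by simp
qed

text \<open>Integrating out the label leaves a Lebesgue integral over \<open>X\<close>, where
  pointwise inequalities between \<open>p\<close>, \<open>q\<close> and the margin set can be
  used.\<close>

lemma integral_class_law:
  fixes p q :: "real ^ 'd \<Rightarrow> real"
  assumes X: "compact X" and p: "bounded_density X K p" and q: "bounded_density X K q"
    and h: "h \<in> borel_measurable (class_law X p q)"
    and B: "\<And>z. z \<in> X \<times> {-1, 1} \<Longrightarrow> \<bar>h z\<bar> \<le> B"
  shows "integrable (restrict_space lborel X) (\<lambda>x. (p x * h (x, 1) + q x * h (x, -1)) / 2)"
    and "(\<integral>z. h z \<partial>class_law X p q) =
      (\<integral>x. (p x * h (x, 1) + q x * h (x, -1)) / 2 \<partial>restrict_space lborel X)"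
proof -
  let ?R = "restrict_space lborel X" and ?C = "count_space {-1, 1 :: int}"
  define k where "k z = (1 / 2) * (if snd z = 1 then p (fst z) else q (fst z))" for z :: "(real ^ 'd) \<times> int"
  interpret R: finite_measure ?R
    by (rule finite_measure_restrict_compact[OF X])
  interpret C: finite_measure ?C by (rule finite_measure_count_space) simp
  interpret RC: pair_sigma_finite ?R ?C ..
  interpret M: finite_measure "?R \<Otimes>\<^sub>M ?C"
    by (rule finite_measure_pair_measure) (rule R.finite_measure_axioms C.finite_measure_axioms)+
  have [measurable]: "p \<in> borel_measurable ?R" "q \<in> borel_measurable ?R"
    using p q by (auto simp: bounded_density_def)
  have sp: "space (?R \<Otimes>\<^sub>M ?C) = X \<times> {-1, 1}"
    by (simp add: space_pair_measure space_restrict_space)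
  have h' [measurable]: "h \<in> borel_measurable (?R \<Otimes>\<^sub>M ?C)"
    using h by (simp add: measurable_cong_sets[OF sets_class_law refl])
  have k [measurable]: "k \<in> borel_measurable (?R \<Otimes>\<^sub>M ?C)" unfolding k_def by measurable
  have kb: "0 \<le> k z" "k z \<le> K" if "z \<in> X \<times> {-1, 1}" for z
  proof -
    have "0 \<le> p (fst z)" "p (fst z) \<le> K" "0 \<le> q (fst z)" "q (fst z) \<le> K"
      using p q that by (auto simp: bounded_density_def)
    then show "0 \<le> k z" "k z \<le> K" by (auto simp: k_def)
  qed
  have law: "class_law X p q = density (?R \<Otimes>\<^sub>M ?C) (\<lambda>z. ennreal (k z))"
    unfolding class_law_def k_def by (simp add: case_prod_unfold)
  have int: "integrable (?R \<Otimes>\<^sub>M ?C) (\<lambda>z. k z * h z)"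
  proof (rule M.integrable_const_bound[where B = "K * B"])
    show "AE z in ?R \<Otimes>\<^sub>M ?C. norm (k z * h z) \<le> K * B"
    proof (rule AE_I2)
      fix z assume "z \<in> space (?R \<Otimes>\<^sub>M ?C)"
      then have z: "z \<in> X \<times> {-1, 1}" by (simp add: sp)
      show "norm (k z * h z) \<le> K * B"
        unfolding real_norm_def abs_mult using kb[OF z] B[OF z] by (intro mult_mono) auto
    qed
  qed simp
  then have int': "integrable (?R \<Otimes>\<^sub>M ?C) (\<lambda>(x, y). k (x, y) * h (x, y))"
    by (simp add: case_prod_unfold)
  have inner: "(\<integral>y. k (x, y) * h (x, y) \<partial>?C) = (p x * h (x, 1) + q x * h (x, -1)) / 2" for x
    by (subst lebesgue_integral_count_space_finite) (simp_all add: k_def field_simps)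
  show "integrable ?R (\<lambda>x. (p x * h (x, 1) + q x * h (x, -1)) / 2)"
    using RC.integrable_fst[OF int'] by (simp only: inner)
  have "(\<integral>z. h z \<partial>class_law X p q) = (\<integral>z. k z *\<^sub>R h z \<partial>(?R \<Otimes>\<^sub>M ?C))"
    unfolding law using kb by (intro integral_density) (auto intro!: AE_I2 simp: sp)
  also have "\<dots> = (\<integral>x. \<integral>y. k (x, y) * h (x, y) \<partial>?C \<partial>?R)"
    using RC.integral_fst[OF int'] by (simp add: case_prod_unfold)
  finally show "(\<integral>z. h z \<partial>class_law X p q) =
      (\<integral>x. (p x * h (x, 1) + q x * h (x, -1)) / 2 \<partial>?R)"
    by (simp only: inner)
qed

text \<open>The reference is the classifier of \<open>fs\<close> instead of
  \<open>bayes_classifier\<close>. Both agree on \<open>X\<close> once \<open>fs = p - q\<close>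
  there, and a Borel \<open>fs\<close> makes the loss measurable without further work.\<close>

definition loss_diff :: "(real ^ 'd \<Rightarrow> real) \<Rightarrow> (real ^ 'd \<Rightarrow> real) \<Rightarrow> (real ^ 'd) \<times> int \<Rightarrow> real" where
  "loss_diff fs f z = of_bool (classifier f (fst z) \<noteq> snd z) - of_bool (classifier fs (fst z) \<noteq> snd z)"

lemma loss_diff_values: "loss_diff fs f z \<in> {-1, 0, 1}"
  by (simp add: loss_diff_def of_bool_def)

lemma measurable_classifier_ne:
  assumes f: "f \<in> borel_measurable borel"
  shows "Measurable.pred (class_law X p q) (\<lambda>z. classifier f (fst z) \<noteq> snd z)"
proof -
  have [measurable]: "f \<in> borel_measurable borel" by (rule f)
  have [measurable]: "classifier f \<in> borel \<rightarrow>\<^sub>M count_space UNIV"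
    unfolding classifier_def by measurable
  have 1: "fst \<in> class_law X p q \<rightarrow>\<^sub>M (borel :: (real ^ 'a) measure)"
  proof -
    have "fst \<in> restrict_space lborel X \<Otimes>\<^sub>M count_space {-1, 1 :: int} \<rightarrow>\<^sub>M restrict_space lborel X"
      by (rule measurable_fst)
    moreover have "(\<lambda>x. x) \<in> restrict_space lborel X \<rightarrow>\<^sub>M (borel :: (real ^ 'a) measure)"
      by (rule measurable_restrict_space1) simp
    ultimately have "(\<lambda>z. fst z) \<in> restrict_space lborel X \<Otimes>\<^sub>M count_space {-1, 1 :: int} \<rightarrow>\<^sub>M borel"
      by (rule measurable_compose)
    then show ?thesis by (simp add: measurable_cong_sets[OF sets_class_law refl])
  qed
  have 2: "snd \<in> class_law X p q \<rightarrow>\<^sub>M count_space UNIV"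
  proof -
    have "snd \<in> restrict_space lborel X \<Otimes>\<^sub>M count_space {-1, 1 :: int} \<rightarrow>\<^sub>M count_space {-1, 1}"
      by (rule measurable_snd)
    moreover have "(\<lambda>y. y) \<in> count_space {-1, 1 :: int} \<rightarrow>\<^sub>M count_space UNIV" by simp
    ultimately have "(\<lambda>z. snd z) \<in> restrict_space lborel X \<Otimes>\<^sub>M count_space {-1, 1 :: int} \<rightarrow>\<^sub>M count_space UNIV"
      by (rule measurable_compose)
    then show ?thesis by (simp add: measurable_cong_sets[OF sets_class_law refl])
  qed
  have [measurable]: "(\<lambda>z. classifier f (fst z)) \<in> class_law X p q \<rightarrow>\<^sub>M count_space UNIV"
    by (rule measurable_compose[OF 1]) measurable
  show ?thesis using 2 by measurable
qed

lemma borel_measurable_loss_diff: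
  assumes "fs \<in> borel_measurable borel" and "f \<in> borel_measurable borel"
  shows "loss_diff fs f \<in> borel_measurable (class_law X p q)"
proof -
  note [measurable] = measurable_classifier_ne[OF assms(1)] measurable_classifier_ne[OF assms(2)]
  show ?thesis unfolding loss_diff_def[abs_def] by measurable
qed

lemma risk_eq_integral:
  assumes X: "X \<in> sets lborel" and p: "bounded_density X K p" and q: "bounded_density X K q"
    and f: "f \<in> borel_measurable borel"
  shows "risk X p q (classifier f) = (\<integral>z. of_bool (classifier f (fst z) \<noteq> snd z) \<partial>class_law X p q)"
    and "integrable (class_law X p q) (\<lambda>z. of_bool (classifier f (fst z) \<noteq> snd z) :: real)"
proof -
  interpret prob_space "class_law X p q" by (rule prob_space_class_law[OF X p q])
  note [measurable] = measurable_classifier_ne[OF f, of X p q]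
  show "integrable (class_law X p q) (\<lambda>z. of_bool (classifier f (fst z) \<noteq> snd z) :: real)"
    by (rule integrable_const_bound[where B = 1]) (auto intro!: AE_I2)
  have "risk X p q (classifier f) =
      (\<integral>z. indicator {z \<in> space (class_law X p q). classifier f (fst z) \<noteq> snd z} z \<partial>class_law X p q)"
    unfolding risk_def by (subst Bochner_Integration.integral_indicator) (auto simp: Int_absorb2)
  also have "\<dots> = (\<integral>z. of_bool (classifier f (fst z) \<noteq> snd z) \<partial>class_law X p q)"
    by (rule Bochner_Integration.integral_cong) (auto simp: indicator_def)
  finally show "risk X p q (classifier f) = (\<integral>z. of_bool (classifier f (fst z) \<noteq> snd z) \<partial>class_law X p q)" .
qed

lemma excess_risk_eq_integral:
  assumes X: "X \<in> sets lborel" and p: "bounded_density X K p" and q: "bounded_density X K q"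
    and f: "f \<in> borel_measurable borel" and fs: "fs \<in> borel_measurable borel"
    and pq: "\<And>x. x \<in> X \<Longrightarrow> p x - q x = fs x"
  shows "excess_risk X p q f = (\<integral>z. loss_diff fs f z \<partial>class_law X p q)"
proof -
  have "bayes_classifier X p q x = classifier fs x" if "x \<in> X" for x
    using pq[OF that] that by (auto simp: bayes_classifier_def classifier_def)
  then have "{z \<in> space (class_law X p q). bayes_classifier X p q (fst z) \<noteq> snd z} =
      {z \<in> space (class_law X p q). classifier fs (fst z) \<noteq> snd z}"
    by (auto simp: space_class_law)
  then have "risk X p q (bayes_classifier X p q) = risk X p q (classifier fs)"
    by (simp add: risk_def)
  then show ?thesis
    using risk_eq_integral[OF X p q f] risk_eq_integral[OF X p q fs]
    by (simp add: excess_risk_def loss_diff_def)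
qed

text \<open>
  The margin condition is used at one fixed level \<open>t\<close> only, which turns it into a second moment
  bound that is linear in the excess risk.
\<close>

lemma second_moment_loss_diff_le:
  fixes p q :: "real ^ 'd \<Rightarrow> real"
  assumes X: "compact X" and p: "bounded_density X K p" and q: "bounded_density X K q"
    and f: "f \<in> borel_measurable borel" and fs: "fs \<in> borel_measurable borel"
    and pq: "\<And>x. x \<in> X \<Longrightarrow> p x - q x = fs x"
    and K: "0 < K" and t: "0 < t" and margin: "measure lborel {x \<in> X. \<bar>fs x\<bar> \<le> t} \<le> c * t"
  shows "(\<integral>z. (loss_diff fs f z)\<^sup>2 \<partial>class_law X p q) \<le> K * (c * t) + 2 * K / t * excess_risk X p q f"
proof -
  let ?R = "restrict_space lborel X" and ?g = "loss_diff fs f"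
  have Xm: "X \<in> sets lborel" using X by (simp add: compact_imp_closed borel_closed)
  interpret R: finite_measure ?R
    by (rule finite_measure_restrict_compact[OF X])
  have [measurable]: "fs \<in> borel_measurable borel" by (rule fs)
  have g: "?g \<in> borel_measurable (class_law X p q)" by (rule borel_measurable_loss_diff[OF fs f])
  have g2: "(\<lambda>z. (?g z)\<^sup>2) \<in> borel_measurable (class_law X p q)" using g by simp
  have gb: "\<bar>?g z\<bar> \<le> 1" "\<bar>(?g z)\<^sup>2\<bar> \<le> 1" for z using loss_diff_values[of fs f z] by auto
  note I1 = integral_class_law[OF X p q g gb(1)]
  note I2 = integral_class_law[OF X p q g2 gb(2)]
  define A where "A = {x \<in> X. \<bar>fs x\<bar> \<le> t}"
  have A: "A \<in> sets lborel"
  proof -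
    have "A = X \<inter> {x \<in> space borel. \<bar>fs x\<bar> \<le> t}" by (auto simp: A_def)
    also have "\<dots> \<in> sets lborel" using Xm by (intro sets.Int) (simp_all, measurable)
    finally show ?thesis .
  qed
  have AR: "A \<in> sets ?R" using A by (auto simp: sets_restrict_space A_def image_iff)
  have iA: "integrable ?R (\<lambda>x. K * indicator A x)"
    using AR by (intro integrable_mult_right R.integrable_const_bound[where B = 1]) auto
  \<comment> \<open>Where the classifiers differ, both squares are 1 and the mean loss difference is
    \<open>\<bar>fs x\<bar> / 2\<close>. The left-hand side is at most \<open>K\<close>, which is
    covered by the indicator if \<open>\<bar>fs x\<bar> \<le> t\<close> and by
    \<open>K * \<bar>fs x\<bar> / t\<close> otherwise.\<close>
  have pt: "(p x * (?g (x, 1))\<^sup>2 + q x * (?g (x, -1))\<^sup>2) / 2 \<le>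
      K * indicator A x + 2 * K / t * ((p x * ?g (x, 1) + q x * ?g (x, -1)) / 2)" if x: "x \<in> X" for x
  proof (cases "classifier f x = classifier fs x")
    case True
    then show ?thesis using K by (simp add: loss_diff_def)
  next
    case False
    have b: "0 \<le> p x" "p x \<le> K" "0 \<le> q x" "q x \<le> K"
      using p q x by (auto simp: bounded_density_def)
    have e: "p x * ?g (x, 1) + q x * ?g (x, -1) = \<bar>fs x\<bar>" "(?g (x, 1))\<^sup>2 = 1" "(?g (x, -1))\<^sup>2 = 1"
      using False pq[OF x] by (auto simp: loss_diff_def classifier_def split: if_splits)
    have "(p x + q x) / 2 \<le> K" using b by simp
    also have "K \<le> K * indicator A x + 2 * K / t * (\<bar>fs x\<bar> / 2)"
    proof (cases "\<bar>fs x\<bar> \<le> t")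
      case True
      then show ?thesis using x K t by (simp add: A_def)
    next
      case False
      then have "K * t \<le> K * \<bar>fs x\<bar>" using K by (intro mult_left_mono) auto
      then have "K \<le> K * \<bar>fs x\<bar> / t" using t by (simp add: pos_le_divide_eq)
      then show ?thesis using False by (simp add: A_def)
    qed
    finally show ?thesis by (simp only: e) simp
  qed
  have "(\<integral>z. (?g z)\<^sup>2 \<partial>class_law X p q) \<le>
      (\<integral>x. K * indicator A x + 2 * K / t * ((p x * ?g (x, 1) + q x * ?g (x, -1)) / 2) \<partial>?R)"
    unfolding I2(2) using pt
    by (intro integral_mono I2(1) Bochner_Integration.integrable_add iA integrable_mult_right I1(1))
      (simp add: space_restrict_space)
  also have "\<dots> = (\<integral>x. K * indicator A x \<partial>?R) +
      (\<integral>x. 2 * K / t * ((p x * ?g (x, 1) + q x * ?g (x, -1)) / 2) \<partial>?R)"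
    by (intro Bochner_Integration.integral_add iA integrable_mult_right I1(1))
  also have "(\<integral>x. 2 * K / t * ((p x * ?g (x, 1) + q x * ?g (x, -1)) / 2) \<partial>?R) =
      2 * K / t * excess_risk X p q f"
    using excess_risk_eq_integral[OF Xm p q f fs pq] I1(2) by simp
  also have "(\<integral>x. K * indicator A x \<partial>?R) = K * measure lborel A"
  proof -
    have "(\<integral>x. indicator A x \<partial>?R) = measure ?R A"
      using AR by (subst Bochner_Integration.integral_indicator) (auto simp: Int_absorb2 sets.sets_into_space)
    also have "\<dots> = measure lborel A"
      using Xm by (intro measure_restrict_space) (auto simp: A_def)
    finally show ?thesis by simp
  qed
  finally have "(\<integral>z. (?g z)\<^sup>2 \<partial>class_law X p q) \<le> K * measure lborel A + 2 * K / t * excess_risk X p q f" .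
  moreover have "K * measure lborel A \<le> K * (c * t)"
    using margin K by (intro mult_left_mono) (auto simp: A_def)
  ultimately show ?thesis by linarith
qed

section \<open>The convergence rate\<close>

lemma dnn_class_relu_nets:
  fixes f :: "real ^ 'd \<Rightarrow> real"
  assumes "f \<in> dnn_class X L N S B F"
  shows "\<exists>\<Theta>\<in>relu_nets CARD('d) L N. f = net_fun \<Theta>"
  using assms by (auto simp: dnn_class_def relu_nets_def hidden_layers_def)

text \<open>
  Multiplying the last layer by a small positive constant enforces the sup bound of the student
  class and does not change the classifier.
\<close>

lemma dnn_class_scale:
  fixes f :: "real ^ 'd \<Rightarrow> real"
  assumes f: "f \<in> dnn_class X L' N' S' B' F'"
    and le: "L' \<le> L" "N' \<le> N" "S' \<le> S" "B' \<le> B"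
    and F: "0 < F" and K: "0 < K" and fK: "\<And>x. x \<in> X \<Longrightarrow> \<bar>f x\<bar> \<le> K"
  shows "\<exists>g\<in>dnn_class X L N S B F. classifier g = classifier f"
proof -
  obtain \<Theta> where \<Theta>: "f = net_fun \<Theta>" "wf_params CARD('d) \<Theta>" "hidden_layers \<Theta> \<le> L'"
    "max_width \<Theta> \<le> N'" "ereal (real (norm0_params \<Theta>)) \<le> S'" "ereal (norm_inf_params \<Theta>) \<le> B'"
    using f by (auto simp: dnn_class_def)
  \<comment> \<open>\<open>c \<le> 1\<close> keeps the parameters within their bound and
    \<open>c * K \<le> F\<close> gives the sup bound; for infinite \<open>F\<close> the teacher is
    left unscaled.\<close>
  obtain c where c: "0 < c" "c \<le> 1" "ereal (c * K) \<le> F"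
  proof (cases F)
    case (real r)
    then have "0 < min 1 (r / K)" "min 1 (r / K) * K \<le> r"
      using F K by (auto simp: min_def field_simps)
    then show ?thesis using that[of "min 1 (r / K)"] real by simp
  next
    case PInf
    then show ?thesis using that[of 1] by simp
  qed (use F in simp)
  let ?\<Theta> = "affine_last c 0 \<Theta>"
  define g :: "real ^ 'd \<Rightarrow> real" where "g = net_fun ?\<Theta>"
  have g: "g x = c * f x" for x
    using net_eval_affine_last[OF \<Theta>(2), of "input_vec x" c 0] by (simp add: g_def \<Theta>(1) net_fun_def)
  have "ereal \<bar>g x\<bar> \<le> F" if "x \<in> X" for x
  proof -
    have "\<bar>g x\<bar> \<le> c * K" using fK[OF that] c by (simp add: g abs_mult)
    then have "ereal \<bar>g x\<bar> \<le> ereal (c * K)" by simp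
    then show ?thesis using c(3) by (rule order_trans)
  qed
  then have "(SUP x\<in>X. ereal \<bar>g x\<bar>) \<le> F" by (rule SUP_least)
  moreover have "ereal (norm_inf_params ?\<Theta>) \<le> B"
  proof -
    have "ereal (norm_inf_params ?\<Theta>) \<le> ereal (norm_inf_params \<Theta>)"
      using norm_inf_affine_last[OF c(1,2) _ \<Theta>(2)] by simp
    then show ?thesis using \<Theta>(6) le(4) by (meson order_trans)
  qed
  moreover have "ereal (real (norm0_params ?\<Theta>)) \<le> S"
    using norm0_affine_last[of c \<Theta>] c(1) \<Theta>(5) le(3) by (simp add: order_trans)
  ultimately have "g \<in> dnn_class X L N S B F"
    unfolding dnn_class_def using \<Theta>(2,3,4) le(1,2)
    by (auto simp: hidden_layers_def intro!: exI[of _ ?\<Theta>] g_def)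
  moreover have "classifier g = classifier f"
    using c(1) by (auto simp: classifier_def g zero_le_mult_iff)
  ultimately show ?thesis by blast
qed

text \<open>The labels and the teacher's values on \<open>w\<close> are fixed, so the vector of loss
  differences is a function of the network's sign pattern.\<close>

lemma card_loss_diff_patterns_le:
  fixes fs :: "real ^ 'd \<Rightarrow> real" and w :: "nat \<Rightarrow> (real ^ 'd) \<times> int"
  assumes "0 < m"
  shows "card ((\<lambda>g. \<lambda>i\<in>{..<m}. g (w i)) ` (\<lambda>\<Theta>. loss_diff fs (net_fun \<Theta>)) ` rational_nets CARD('d) r N)
    \<le> (m + 1) ^ ((CARD('d) + 1) * (N + 1) ^ r * (2 * r + 1))"
proof -
  define \<psi> where "\<psi> S = (\<lambda>i\<in>{..<m}. (of_bool ((if i \<in> S then 1 else - 1) \<noteq> snd (w i)) -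
    of_bool (classifier fs (fst (w i)) \<noteq> snd (w i)) :: real))" for S :: "nat set"
  let ?\<phi> = "\<lambda>i. input_vec (fst (w i))"
  let ?SP = "sign_patterns CARD('d) r N ?\<phi> {..<m}"
  have "(\<lambda>g. \<lambda>i\<in>{..<m}. g (w i)) ` (\<lambda>\<Theta>. loss_diff fs (net_fun \<Theta>)) ` rational_nets CARD('d) r N \<subseteq> \<psi> ` ?SP"
  proof
    fix v assume "v \<in> (\<lambda>g. \<lambda>i\<in>{..<m}. g (w i)) ` (\<lambda>\<Theta>. loss_diff fs (net_fun \<Theta>)) ` rational_nets CARD('d) r N"
    then obtain \<Theta> where \<Theta>: "\<Theta> \<in> relu_nets CARD('d) r N"
      and v: "v = (\<lambda>i\<in>{..<m}. loss_diff fs (net_fun \<Theta>) (w i))"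
      by (auto simp: rational_nets_def)
    have "v = \<psi> {i \<in> {..<m}. 0 \<le> vec_index (net_eval \<Theta> (?\<phi> i)) 0}"
      unfolding v \<psi>_def by (rule restrict_ext) (simp add: loss_diff_def classifier_def net_fun_def)
    then show "v \<in> \<psi> ` ?SP" using \<Theta> by (auto simp: sign_patterns_def)
  qed
  then have "card ((\<lambda>g. \<lambda>i\<in>{..<m}. g (w i)) ` (\<lambda>\<Theta>. loss_diff fs (net_fun \<Theta>)) ` rational_nets CARD('d) r N)
      \<le> card (\<psi> ` ?SP)"
    by (intro card_mono finite_imageI finite_sign_patterns) simp_all
  also have "\<dots> \<le> card ?SP" by (rule card_image_le) (simp add: finite_sign_patterns)
  also have "\<dots> \<le> (card {..<m} + 1) ^ ((CARD('d) + 1) * (N + 1) ^ r * (2 * r + 1))"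
    using assms by (intro card_sign_patterns_le) auto
  finally show ?thesis by simp
qed

lemma abs_excess_risk_le:
  fixes p q :: "real ^ 'd \<Rightarrow> real"
  assumes "prob_space (class_law X p q)"
  shows "\<bar>excess_risk X p q f\<bar> \<le> 1"
proof -
  interpret prob_space "class_law X p q" by (rule assms)
  have "0 \<le> risk X p q C" "risk X p q C \<le> 1" for C
    by (simp_all add: risk_def)
  from this[of "classifier f"] this[of "bayes_classifier X p q"] show ?thesis
    by (simp add: excess_risk_def abs_le_iff)
qed

text \<open>Nonasymptotic form with a free level \<open>t\<close>; its choice and all growth
  conditions are left to the theorem. In \<open>erm\<close> the comparison is with \<open>fs\<close>
  itself, which enters through its classifier alone.\<close>

lemma expected_excess_risk_le:
  fixes X :: "(real ^ 'd) set" and p q fs :: "real ^ 'd \<Rightarrow> real"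
    and fh :: "(nat \<Rightarrow> (real ^ 'd) \<times> int) \<Rightarrow> real ^ 'd \<Rightarrow> real"
  assumes n: "0 < n" and X: "compact X"
    and p: "bounded_density X K p" and q: "bounded_density X K q"
    and fs: "fs \<in> borel_measurable borel" and pq: "\<And>x. x \<in> X \<Longrightarrow> p x - q x = fs x"
    and t: "0 < t" "t \<le> 6 * K"
    and margin: "measure lborel {x \<in> X. \<bar>fs x\<bar> \<le> t} \<le> c * t"
    and fh: "\<And>D. D \<in> PiE {..<n} (\<lambda>_. X \<times> {-1, 1}) \<Longrightarrow> \<exists>\<Theta>\<in>relu_nets CARD('d) L N. fh D = net_fun \<Theta>"
    and erm: "\<And>D. D \<in> PiE {..<n} (\<lambda>_. X \<times> {-1, 1}) \<Longrightarrow> empirical_risk n D (fh D) \<le> empirical_risk n D fs"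
    and meas: "(\<lambda>D. excess_risk X p q (fh D)) \<in> borel_measurable (sample_law n X p q)"
  defines "E \<equiv> (CARD('d) + 1) * (N + 1) ^ L * (2 * L + 1)"
  shows "(\<integral>D. excess_risk X p q (fh D) \<partial>sample_law n X p q) \<le>
    c * t\<^sup>2 / 2 + 48 * K * (real E * ln (real (2 * n + 1))) / (t * real n)"
proof -
  let ?P = "class_law X p q"
  have K: "0 < K" using t by simp
  have Xm: "X \<in> sets lborel" using X by (simp add: compact_imp_closed borel_closed)
  have P: "prob_space ?P" by (rule prob_space_class_law[OF Xm p q])
  interpret P: prob_space ?P by (rule P)
  interpret S: prob_space "sample_law n X p q"
    unfolding sample_law_def by (rule prob_space_PiM) (rule P)
  define M where "M = (2 * n + 1) ^ E"
  \<comment> \<open>Chosen so that \<open>3 * \<eta> * (2 * K / t) = 1 / 2\<close>: half of the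
    excess risk pays for the second moment. The assumption \<open>t \<le> 6 * K\<close> is the same
    as \<open>\<eta> \<le> 1 / 2\<close>.\<close>
  define \<eta> where "\<eta> = t / (12 * K)"
  have \<eta>: "0 < \<eta>" "\<eta> \<le> 1 / 2" using t K by (auto simp: \<eta>_def field_simps)
  define G where "G = (\<lambda>\<Theta>. loss_diff fs (net_fun \<Theta> :: real ^ 'd \<Rightarrow> real)) ` rational_nets CARD('d) L N"
  define e where "e D = excess_risk X p q (fh D)" for D
  \<comment> \<open>The half of the excess risk that remains, minus
    \<open>3 * \<eta> * (K * (c * t)) = c * t\<^sup>2 / 4\<close>.\<close>
  define \<phi> where "\<phi> D = e D / 2 - c * t\<^sup>2 / 4" for D
  have "(\<integral>\<^sup>+D. ennreal (exp (\<eta> / 2 * real n * \<phi> D)) \<partial>PiM {..<n} (\<lambda>_. ?P)) \<le> ennreal (real M)"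
  proof (rule nn_integral_exp_selected_le[OF P, of G, OF _ _ _ _ \<eta>])
    show "countable G" unfolding G_def by (intro countable_image countable_rational_nets)
    show "g \<in> borel_measurable ?P" if "g \<in> G" for g
      using that fs borel_measurable_net_fun unfolding G_def rational_nets_def relu_nets_def
      by (auto intro!: borel_measurable_loss_diff)
    show "g z \<in> {-1, 0, 1}" if "g \<in> G" for g z
      using that loss_diff_values unfolding G_def by blast
    show "card ((\<lambda>g. \<lambda>i\<in>{..<2 * n}. g (w i)) ` G) \<le> M" for w
      unfolding G_def M_def E_def using card_loss_diff_patterns_le[of "2 * n" w fs L N] n by simp
    fix D assume "D \<in> {..<n} \<rightarrow>\<^sub>E space ?P"
    then have D: "D \<in> PiE {..<n} (\<lambda>_. X \<times> {-1, 1})" by (simp add: space_class_law)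
    obtain \<Theta> where \<Theta>: "\<Theta> \<in> relu_nets CARD('d) L N" "fh D = net_fun \<Theta>" using fh[OF D] by blast
    have f: "fh D \<in> borel_measurable borel"
      unfolding \<Theta>(2) using \<Theta>(1) by (intro borel_measurable_net_fun) (simp add: relu_nets_def)
    let ?h = "loss_diff fs (fh D)"
    have 1: "?h \<in> borel_measurable ?P" by (rule borel_measurable_loss_diff[OF fs f])
    have 2: "\<forall>z\<in>space ?P. ?h z \<in> {-1, 0, 1}" using loss_diff_values by blast
    have 3: "(\<Sum>i<n. ?h (D i)) \<le> 0"
    proof -
      have "(\<Sum>i<n. ?h (D i)) = real n * (empirical_risk n D (fh D) - empirical_risk n D fs)"
        using n by (simp add: loss_diff_def empirical_risk_def sum_subtractf right_diff_distrib)
      also have "\<dots> \<le> 0" using erm[OF D] by (intro mult_nonneg_nonpos) auto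
      finally show ?thesis .
    qed
    have 4: "\<forall>w\<in>{..<2 * n} \<rightarrow>\<^sub>E space ?P. \<exists>g\<in>G. \<forall>i<2 * n. g (w i) = ?h (w i)"
    proof
      fix w :: "nat \<Rightarrow> (real ^ 'd) \<times> int"
      obtain \<Theta>' where \<Theta>': "\<Theta>' \<in> rational_nets CARD('d) L N"
        "\<forall>i\<in>{..<2 * n}. 0 \<le> vec_index (net_eval \<Theta>' (input_vec (fst (w i)))) 0 \<longleftrightarrow>
          0 \<le> vec_index (net_eval \<Theta> (input_vec (fst (w i)))) 0"
        using sign_pattern_rational[OF \<Theta>(1), of "{..<2 * n}" "\<lambda>i. input_vec (fst (w i))"] by auto
      have "\<forall>i<2 * n. loss_diff fs (net_fun \<Theta>') (w i) = ?h (w i)"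
        using \<Theta>'(2) by (simp add: loss_diff_def classifier_def net_fun_def \<Theta>(2))
      then show "\<exists>g\<in>G. \<forall>i<2 * n. g (w i) = ?h (w i)"
        unfolding G_def using \<Theta>'(1) by blast
    qed
    have 5: "\<phi> D \<le> (\<integral>z. ?h z \<partial>?P) - 3 * \<eta> * (\<integral>z. (?h z)\<^sup>2 \<partial>?P)"
    proof -
      have "3 * \<eta> * (\<integral>z. (?h z)\<^sup>2 \<partial>?P) \<le> 3 * \<eta> * (K * (c * t) + 2 * K / t * e D)"
        unfolding e_def using \<eta>
        by (intro mult_left_mono second_moment_loss_diff_le[OF X p q f fs pq K t(1) margin]) auto
      also have "\<dots> = c * t\<^sup>2 / 4 + e D / 2"
        using K t by (simp add: \<eta>_def field_simps power2_eq_square)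
      finally show ?thesis
        using excess_risk_eq_integral[OF Xm p q f fs pq] by (simp add: \<phi>_def e_def)
    qed
    show "\<exists>h. h \<in> borel_measurable ?P \<and> (\<forall>z\<in>space ?P. h z \<in> {-1, 0, 1}) \<and>
        (\<Sum>i<n. h (D i)) \<le> 0 \<and>
        (\<forall>w\<in>{..<2 * n} \<rightarrow>\<^sub>E space ?P. \<exists>g\<in>G. \<forall>i<2 * n. g (w i) = h (w i)) \<and>
        \<phi> D \<le> (\<integral>z. h z \<partial>?P) - 3 * \<eta> * (\<integral>z. (h z)\<^sup>2 \<partial>?P)"
      using 1 2 3 4 5 by blast
  qed
  then have le: "(\<integral>\<^sup>+D. ennreal (exp (\<eta> / 2 * real n * \<phi> D)) \<partial>sample_law n X p q) \<le> ennreal (real M)"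
    by (simp add: sample_law_def)
  have ie: "integrable (sample_law n X p q) e"
    using meas abs_excess_risk_le[OF P] unfolding e_def[abs_def]
    by (intro S.integrable_const_bound[where B = 1]) auto
  then have i\<phi>: "integrable (sample_law n X p q) \<phi>" by (simp add: \<phi>_def[abs_def])
  have "S.expectation \<phi> \<le> ln (real M) / (\<eta> / 2 * real n)"
    using \<eta> n by (intro S.expectation_le_of_nn_integral_exp[OF i\<phi> _ _ le]) (auto simp: M_def)
  also have "S.expectation \<phi> = S.expectation e / 2 - c * t\<^sup>2 / 4"
    unfolding \<phi>_def using ie by (simp add: S.prob_space)
  also have "ln (real M) = real E * ln (real (2 * n + 1))"
    unfolding M_def of_nat_power by (rule ln_realpow)
  \<comment> \<open>Solving for the mean of \<open>e\<close> doubles both terms; the factor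
    \<open>2 / (\<eta> / 2) = 4 / \<eta>\<close> is \<open>48 * K / t\<close>.\<close>
  finally have "S.expectation e \<le> c * t\<^sup>2 / 2 + 2 * (real E * ln (real (2 * n + 1)) / (\<eta> / 2 * real n))"
    by simp
  also have "2 * (real E * ln (real (2 * n + 1)) / (\<eta> / 2 * real n)) =
      48 * K * (real E * ln (real (2 * n + 1))) / (t * real n)"
    using K t n by (simp add: \<eta>_def field_simps)
  finally show ?thesis by (simp only: e_def)
qed

text \<open>Allows the teacher's depth to be replaced by a bound independent of \<open>n\<close>;
  monotonicity in the exponent needs a logarithm of at least 1.\<close>

lemma noise_bound_mono:
  assumes "1 \<le> ln (real n)" and "0 \<le> m" and "L \<le> L'" and "0 \<le> K"
  shows "noise_bound d K m n L \<le> noise_bound d K m n L'"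
  using assms by (auto simp: noise_bound_def intro!: mult_left_mono powr_mono)

theorem theorem3p2:
  fixes X :: "(real ^ 'd) set"
    and K m m_star :: real
    and L_star N_star L N :: "nat \<Rightarrow> nat"
    and S_star B_star F_star S B F :: "nat \<Rightarrow> ereal"
    and f_hat :: "nat \<Rightarrow> (nat \<Rightarrow> (real ^ 'd) \<times> int) \<Rightarrow> real ^ 'd \<Rightarrow> real"
  assumes "compact X" and "0 < emeasure lborel X"
    and "0 < K" and "1 \<le> m_star" and "m_star \<le> m"
    and "\<And>n. 0 < S_star n" and "\<And>n. 0 < B_star n" and "\<And>n. 0 < F_star n"
    and "\<And>n. 0 < S n" and "\<And>n. 0 < B n" and "\<And>n. 0 < F n"
    and "(\<lambda>n. real (L_star n)) \<in> O(\<lambda>_. 1)"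
    and "(\<lambda>n. real (N_star n)) \<in> O(\<lambda>n. ln (real n) powr m_star)"
    and "(\<lambda>n. real (L n)) \<in> O(\<lambda>_. 1)"
    and "(\<lambda>n. real (N n)) \<in> O(\<lambda>n. ln (real n) powr m)"
    and "\<And>n. L_star n \<le> L n" and "\<And>n. S_star n \<le> S n"
    and "\<And>n. N_star n \<le> N n" and "\<And>n. B_star n \<le> B n"
    and "\<And>n D. D \<in> PiE {..<n} (\<lambda>_. X \<times> {-1, 1}) \<Longrightarrow>
           is_arg_min (empirical_risk n D)
             (\<lambda>g. g \<in> dnn_class X (L n) (N n) (S n) (B n) (F n)) (f_hat n D)"
    and "\<And>n p q. (p, q) \<in> teacher_pairs X K m_star n
             (L_star n) (N_star n) (S_star n) (B_star n) (F_star n) \<Longrightarrow>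
           (\<lambda>D. excess_risk X p q (f_hat n D)) \<in> borel_measurable (sample_law n X p q)"
  shows "\<exists>C>0. \<exists>\<gamma>>0. \<forall>\<^sub>F n in sequentially.
    (SUP (p, q) \<in> teacher_pairs X K m_star n
         (L_star n) (N_star n) (S_star n) (B_star n) (F_star n).
       ereal (\<integral>D. excess_risk X p q (f_hat n D) \<partial>sample_law n X p q))
    \<le> ereal (C * ln (real n) powr \<gamma> * real n powr (- 2 / 3))"
proof -
  note X = assms(1) and K = assms(3) and ms = assms(4) and msm = assms(5)
  obtain L1 where L1: "\<forall>\<^sub>F n in sequentially. L n \<le> L1"
  proof -
    obtain b where "\<forall>\<^sub>F n in sequentially. norm (real (L n)) \<le> b * norm (1 :: real)"
      using landau_o.bigE[OF assms(14)] by blast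
    then have "\<forall>\<^sub>F n in sequentially. L n \<le> nat \<lceil>b\<rceil>"
      by eventually_elim (simp, linarith)
    then show ?thesis by (rule that)
  qed
  obtain b where b: "0 < b" "\<forall>\<^sub>F n in sequentially. norm (real (N n)) \<le> b * norm (ln (real n) powr m)"
    using landau_o.bigE[OF assms(15)] by blast
  define d where "d = CARD('d)"
  \<comment> \<open>With depths bounded by \<open>L1\<close> all exponents are constants:
    \<open>a\<close> for the noise bound, \<open>m * real L1\<close> for the pattern count and 1 for
    the logarithm of the sample size add up to \<open>\<gamma>\<close>. In \<open>C\<close>,
    \<open>K / 2\<close> stems from \<open>c * t\<^sup>2 / 2\<close>, and \<open>96 * K\<close> is
    \<open>48 * K\<close> doubled by \<open>ln (2 * n + 1) \<le> 2 * ln n\<close>.\<close>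
  define a where "a = m_star * (real d)\<^sup>2 * real L1"
  define C1 where "C1 = real ((d + 1) * (2 * L1 + 1)) * (b + 1) ^ L1"
  define C where "C = K / 2 + 96 * K * C1"
  define \<gamma> where "\<gamma> = a + m * real L1 + 1"
  have a0: "0 \<le> a" using ms by (simp add: a_def)
  have m1: "1 \<le> m" using ms msm by simp
  have C1: "0 < C1" 
  proof -
    have "0 < real ((d + 1) * (2 * L1 + 1))" by (subst of_nat_0_less_iff) simp
    then show ?thesis unfolding C1_def using b(1) by (intro mult_pos_pos zero_less_power) simp_all
  qed
  have C0: "0 < C" using K C1 by (simp add: C_def add_pos_pos)
  have \<gamma>0: "0 < \<gamma>" using a0 m1 by (simp add: \<gamma>_def add_nonneg_pos)
  have ev1: "\<forall>\<^sub>F n in sequentially. 1 \<le> ln (real n)" by real_asymp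
  \<comment> \<open>The two conditions on \<open>t = n powr (- 1 / 3)\<close>: this one gives
    \<open>t \<le> 6 * K\<close>, and \<open>ev3\<close> gives \<open>1 / T \<le> 1 / t\<close>, so
    that the margin condition applies at \<open>t\<close>.\<close>
  have ev2: "\<forall>\<^sub>F n in sequentially. real n powr (- 1 / 3) \<le> 6 * K" using K by real_asymp
  have ev3: "\<forall>\<^sub>F n in sequentially. K * ln (real n) powr a \<le> real n powr (1 / 3)" using K a0 by real_asymp
  have "\<forall>\<^sub>F n in sequentially.
    (SUP (p, q) \<in> teacher_pairs X K m_star n
         (L_star n) (N_star n) (S_star n) (B_star n) (F_star n).
       ereal (\<integral>D. excess_risk X p q (f_hat n D) \<partial>sample_law n X p q))
    \<le> ereal (C * ln (real n) powr \<gamma> * real n powr (- 2 / 3))"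
    using L1 b(2) ev1 ev2 ev3 eventually_ge_at_top[of 3]
  proof eventually_elim
    case (elim n)
    define l where "l = ln (real n)"
    define t where "t = real n powr (- 1 / 3)"
    define r where "r = real n powr (- 2 / 3)"
    have n: "3 \<le> n" and l1: "1 \<le> l" and LL: "L n \<le> L1" and NN: "real (N n) \<le> b * l powr m"
      using elim by (simp_all add: l_def)
    have t0: "0 < t" "t \<le> 6 * K" using elim n by (simp_all add: t_def)
    have r0: "0 < r" using n by (simp add: r_def)
    \<comment> \<open>Both error terms have the same size \<open>r\<close>, since
      \<open>t\<^sup>2 = r\<close> and \<open>1 / (t * real n) = r\<close>.\<close>
    have t2: "t\<^sup>2 = r" "t * real n = 1 / r" "1 / t = real n powr (1 / 3)"
    proof -
      show "t\<^sup>2 = r" using n by (simp add: t_def r_def powr_power)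
      have "t * real n = real n powr (- 1 / 3 + 1)" unfolding t_def powr_add using n by simp
      also have "\<dots> = 1 / r" using n by (simp add: r_def powr_minus_divide)
      finally show "t * real n = 1 / r" .
      show "1 / t = real n powr (1 / 3)" using n by (simp add: t_def powr_minus_divide)
    qed
    define E where "E = (d + 1) * (N n + 1) ^ L n * (2 * L n + 1)"
    have l\<gamma>: "l powr u \<le> l powr \<gamma>" if "u \<le> \<gamma>" for u using l1 that by (intro powr_mono) auto
    have lm: "1 \<le> l powr m" using l1 m1 by (simp add: ge_one_powr_ge_zero)
    have E_le: "real E * l \<le> C1 * l powr \<gamma>"
    proof -
      have "real (N n + 1) \<le> (b + 1) * l powr m" using NN lm by (simp add: distrib_right)
      then have "real (N n + 1) ^ L n \<le> ((b + 1) * l powr m) ^ L n" by (intro power_mono) auto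
      also have "\<dots> \<le> ((b + 1) * l powr m) ^ L1"
      proof (rule power_increasing[OF LL])
        have "1 * 1 \<le> (b + 1) * l powr m" using b lm by (intro mult_mono) auto
        then show "1 \<le> (b + 1) * l powr m" by simp
      qed
      also have "\<dots> = (b + 1) ^ L1 * l powr (m * real L1)"
        using l1 by (simp add: power_mult_distrib powr_power mult.commute)
      finally have "real (N n + 1) ^ L n \<le> (b + 1) ^ L1 * l powr (m * real L1)" .
      moreover have "real ((d + 1) * (2 * L n + 1)) \<le> real ((d + 1) * (2 * L1 + 1))"
        using LL by (intro of_nat_mono mult_le_mono) auto
      ultimately have "real ((d + 1) * (2 * L n + 1)) * real (N n + 1) ^ L n \<le>
          real ((d + 1) * (2 * L1 + 1)) * ((b + 1) ^ L1 * l powr (m * real L1))"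
        by (intro mult_mono) auto
      moreover have "real E = real ((d + 1) * (2 * L n + 1)) * real (N n + 1) ^ L n"
        unfolding E_def of_nat_mult of_nat_power by (simp only: mult_ac)
      ultimately have "real E \<le> C1 * l powr (m * real L1)" by (simp add: C1_def mult.assoc)
      then have "real E * l \<le> C1 * l powr (m * real L1) * l" using l1 by (intro mult_right_mono) auto
      also have "\<dots> = C1 * l powr (m * real L1 + 1)" using l1 by (simp add: powr_add)
      also have "\<dots> \<le> C1 * l powr \<gamma>" using C1 a0 by (intro mult_left_mono l\<gamma>) (auto simp: \<gamma>_def)
      finally show ?thesis .
    qed
    \<comment> \<open>Rests on \<open>2 * n + 1 \<le> n ^ 2\<close>, which is the reason for
      requiring \<open>n \<ge> 3\<close>.\<close>
    have ln_le: "ln (real (2 * n + 1)) \<le> 2 * l"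
    proof -
      have "3 * n \<le> n * n" using n by (rule mult_le_mono1)
      then have "2 * n + 1 \<le> n ^ 2" using n unfolding power2_eq_square by linarith
      then have "real (2 * n + 1) \<le> real n ^ 2" by (metis of_nat_le_iff of_nat_power)
      then have "ln (real (2 * n + 1)) \<le> ln (real n ^ 2)" using n by (subst ln_le_cancel_iff) auto
      then show ?thesis using n by (simp add: l_def ln_realpow)
    qed
    have main: "(\<integral>D. excess_risk X p q (f_hat n D) \<partial>sample_law n X p q) \<le> C * l powr \<gamma> * r"
      if pq: "(p, q) \<in> teacher_pairs X K m_star n (L_star n) (N_star n) (S_star n) (B_star n) (F_star n)" for p q
    proof -
      from pq have "bounded_density X K p" "bounded_density X K q"
        and "\<exists>f \<in> dnn_class X (L_star n) (N_star n) (S_star n) (B_star n) (F_star n).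
          (\<forall>x\<in>X. p x - q x = f x) \<and>
          (\<exists>c T. 0 < c \<and> 0 < T \<and> c \<le> noise_bound d K m_star n (L_star n) \<and>
            1 / T \<le> noise_bound d K m_star n (L_star n) \<and>
            (\<forall>t. 0 \<le> t \<and> t \<le> T \<longrightarrow> measure lborel {x\<in>X. \<bar>f x\<bar> \<le> t} \<le> c * t))"
        by (simp_all add: teacher_pairs_def d_def)
      then obtain fs c T where p: "bounded_density X K p" and q: "bounded_density X K q"
        and fs: "fs \<in> dnn_class X (L_star n) (N_star n) (S_star n) (B_star n) (F_star n)"
        and pqf: "\<forall>x\<in>X. p x - q x = fs x"
        and cT: "0 < c" "0 < T" "c \<le> noise_bound d K m_star n (L_star n)"
          "1 / T \<le> noise_bound d K m_star n (L_star n)"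
        and margin: "\<forall>t. 0 \<le> t \<and> t \<le> T \<longrightarrow> measure lborel {x \<in> X. \<bar>fs x\<bar> \<le> t} \<le> c * t"
        by (elim bexE exE conjE)
      have nb: "noise_bound d K m_star n (L_star n) \<le> K * l powr a"
        using noise_bound_mono[of n m_star "L_star n" L1 K d] l1 ms K LL assms(16)[of n]
        by (simp add: noise_bound_def a_def l_def)
      have "1 / T \<le> 1 / t" using cT(4) nb elim(5) t2(3) by (simp add: l_def)
      then have "t \<le> T" using cT(2) t0 by (simp add: field_simps)
      then have mt: "measure lborel {x \<in> X. \<bar>fs x\<bar> \<le> t} \<le> c * t" using margin t0 by simp
      obtain \<Theta> where "\<Theta> \<in> relu_nets CARD('d) (L_star n) (N_star n)" "fs = net_fun \<Theta>"
        using dnn_class_relu_nets[OF fs] by blast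
      then have fsm: "fs \<in> borel_measurable borel"
        using borel_measurable_net_fun[where ?'d = 'd, of \<Theta>] by (simp add: relu_nets_def)
      have fsK: "\<bar>fs x\<bar> \<le> K" if "x \<in> X" for x
      proof -
        have "0 \<le> p x" "p x \<le> K" "0 \<le> q x" "q x \<le> K"
          using p q that by (auto simp: bounded_density_def)
        then show ?thesis using bspec[OF pqf that] by linarith
      qed
      \<comment> \<open>\<open>fs\<close> may exceed the student's bound \<open>F n\<close>.
        Minimality is applied to the rescaled \<open>g\<close>, whose empirical risk is that of
        \<open>fs\<close>; the scale exists because a difference of densities in
        \<open>[0, K]\<close> is bounded by \<open>K\<close>.\<close>
      obtain g where g: "g \<in> dnn_class X (L n) (N n) (S n) (B n) (F n)" "classifier g = classifier fs"
        using dnn_class_scale[OF fs assms(16) assms(18) assms(17) assms(19) assms(11) K fsK] by blast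
      have fh: "f_hat n D \<in> dnn_class X (L n) (N n) (S n) (B n) (F n)"
        and erm: "empirical_risk n D (f_hat n D) \<le> empirical_risk n D fs"
        if "D \<in> PiE {..<n} (\<lambda>_. X \<times> {-1, 1})" for D
      proof -
        have "is_arg_min (empirical_risk n D)
             (\<lambda>g. g \<in> dnn_class X (L n) (N n) (S n) (B n) (F n)) (f_hat n D)"
          by (rule assms(20)[OF that])
        then show "f_hat n D \<in> dnn_class X (L n) (N n) (S n) (B n) (F n)"
          and "empirical_risk n D (f_hat n D) \<le> empirical_risk n D fs"
          using g by (auto simp: is_arg_min_def empirical_risk_def not_less)
      qed
      have n0: "0 < n" using n by simp
      have "(\<integral>D. excess_risk X p q (f_hat n D) \<partial>sample_law n X p q) \<le>
          c * t\<^sup>2 / 2 + 48 * K * (real ((CARD('d) + 1) * (N n + 1) ^ L n * (2 * L n + 1)) *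
            ln (real (2 * n + 1))) / (t * real n)"
        by (rule expected_excess_risk_le[OF n0 X p q fsm bspec[OF pqf] t0 mt
          dnn_class_relu_nets[OF fh] erm assms(21)[OF pq]])
      also have "\<dots> = c * r / 2 + 48 * K * (real E * ln (real (2 * n + 1))) * r"
        unfolding t2(1,2) by (simp add: E_def d_def)
      also have "\<dots> \<le> K * l powr \<gamma> * r / 2 + 48 * K * (2 * (C1 * l powr \<gamma>)) * r"
      proof (rule add_mono)
        have "c \<le> K * l powr \<gamma>"
        proof -
          have "K * l powr a \<le> K * l powr \<gamma>"
            using K m1 by (intro mult_left_mono l\<gamma>) (auto simp: \<gamma>_def)
          then show ?thesis using cT(3) nb by linarith
        qed
        then show "c * r / 2 \<le> K * l powr \<gamma> * r / 2" using r0 by simp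
        have "real E * ln (real (2 * n + 1)) \<le> real E * (2 * l)"
          using ln_le by (intro mult_left_mono) auto
        also have "\<dots> \<le> 2 * (C1 * l powr \<gamma>)" using E_le by simp
        finally show "48 * K * (real E * ln (real (2 * n + 1))) * r \<le> 48 * K * (2 * (C1 * l powr \<gamma>)) * r"
          using K r0 by (intro mult_right_mono mult_left_mono) auto
      qed
      also have "\<dots> = C * l powr \<gamma> * r" by (simp add: C_def algebra_simps)
      finally show ?thesis .
    qed
    show ?case
    proof (rule SUP_least)
      fix z assume "z \<in> teacher_pairs X K m_star n (L_star n) (N_star n) (S_star n) (B_star n) (F_star n)"
      then show "(case z of (p, q) \<Rightarrow> ereal (\<integral>D. excess_risk X p q (f_hat n D) \<partial>sample_law n X p q)) \<le>
          ereal (C * ln (real n) powr \<gamma> * real n powr (- 2 / 3))"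
        using main by (cases z) (simp add: l_def r_def)
    qed
  qed
  then show ?thesis using C0 \<gamma>0 by blast
qed

end
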